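(* Let $G$ be a bipartite graph with bipartition $V(G)=X\cup Y$ and let $I=I(G)$ be its edge ideal. For all $s\ge 1$, $$\operatorname{reg}(I^s)\le 2s+\min\big\{|X|-1,\;|Y|-1,\;2b(G)-1\big\}.$$
   Context: Let $G$ be a bipartite graph with bipartition $X=\{x_1,\ldots,x_n\}$, $Y=\{y_1,\ldots,y_m\}$ of its vertex set, $\mathbb{K}$ a field, and $R=\mathbb{K}[x_1,\ldots,x_n,y_1,\ldots,y_m]$ with its standard grading. The edge ideal $I(G)\subset R$ is generated by the monomials $x_iy_j$ with $x_i$ adjacent to $y_j$. $b(G)$ is the minimum cardinality of a maximal (with respect to inclusion) matching of $G$, and $\operatorname{reg}$ of a homogeneous ideal of $R$ denotes its Castelnuovo–Mumford regularity as a graded $R$-module. *)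

theory Defs
  imports Complex_Main "HOL-Library.Poly_Mapping" "HOL-Library.Extended_Real"
begin

section \<open>Bipartite graphs and matchings\<close>

definition bipartite_graph :: "'v set \<Rightarrow> 'v set \<Rightarrow> 'v set set \<Rightarrow> bool" where
  "bipartite_graph X Y E \<longleftrightarrow> finite X \<and> finite Y \<and> X \<inter> Y = {} \<and>
     (\<forall>e\<in>E. \<exists>x\<in>X. \<exists>y\<in>Y. e = {x, y})"

definition matching :: "'v set set \<Rightarrow> 'v set set \<Rightarrow> bool" where
  "matching E M \<longleftrightarrow> M \<subseteq> E \<and> (\<forall>e\<in>M. \<forall>f\<in>M. e \<noteq> f \<longrightarrow> e \<inter> f = {})"

definition maximal_matching :: "'v set set \<Rightarrow> 'v set set \<Rightarrow> bool" where
  "maximal_matching E M \<longleftrightarrow> matching E M \<and> (\<forall>M'. matching E M' \<longrightarrow> M \<subseteq> M' \<longrightarrow> M' = M)"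

definition min_max_matching_number :: "'v set set \<Rightarrow> nat" where
  "min_max_matching_number E = Min (card ` {M. maximal_matching E M})"


section \<open>Polynomial rings and ideals\<close>

text \<open>The type \<open>('v, 'k) mpoly\<close> has one variable for every element of \<open>'v\<close>. The polynomial
  ring in the finitely many variables indexed by \<open>V\<close> is its subring \<open>poly_ring V\<close>.\<close>

type_synonym ('v, 'k) mpoly = "('v \<Rightarrow>\<^sub>0 nat) \<Rightarrow>\<^sub>0 'k"

definition poly_ring :: "'v set \<Rightarrow> ('v, 'k::field) mpoly set" where
  "poly_ring V = {p. \<forall>m\<in>Poly_Mapping.keys p. Poly_Mapping.keys m \<subseteq> V}"

definition var :: "'v \<Rightarrow> ('v, 'k::field) mpoly" where
  "var v = Poly_Mapping.single (Poly_Mapping.single v 1) 1"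

definition monom_degree :: "('v \<Rightarrow>\<^sub>0 nat) \<Rightarrow> nat" where
  "monom_degree m = (\<Sum>v\<in>Poly_Mapping.keys m. Poly_Mapping.lookup m v)"

text \<open>The zero polynomial is homogeneous of every degree, and it is the only one that is
  homogeneous of a negative degree.\<close>

definition homogeneous :: "int \<Rightarrow> ('v, 'k::field) mpoly \<Rightarrow> bool" where
  "homogeneous d p \<longleftrightarrow> (\<forall>m\<in>Poly_Mapping.keys p. int (monom_degree m) = d)"

definition gen_ideal :: "'v set \<Rightarrow> ('v, 'k::field) mpoly set \<Rightarrow> ('v, 'k) mpoly set" where
  "gen_ideal V B =
     {(\<Sum>b\<in>A. q b * b) | A q. finite A \<and> A \<subseteq> B \<and> (\<forall>b\<in>A. q b \<in> poly_ring V)}"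

definition ideal_power :: "'v set \<Rightarrow> ('v, 'k::field) mpoly set \<Rightarrow> nat \<Rightarrow> ('v, 'k) mpoly set" where
  "ideal_power V I s = gen_ideal V {(\<Prod>i<s. f i) | f. \<forall>i<s. f i \<in> I}"

definition edge_ideal :: "'v set \<Rightarrow> 'v set \<Rightarrow> 'v set set \<Rightarrow> ('v, 'k::field) mpoly set" where
  "edge_ideal X Y E =
     gen_ideal (X \<union> Y) {var x * var y | x y. x \<in> X \<and> y \<in> Y \<and> {x, y} \<in> E}"


section \<open>Minimal graded free resolutions and Castelnuovo--Mumford regularity\<close>

definition free_module :: "'v set \<Rightarrow> nat \<Rightarrow> (nat \<Rightarrow> ('v, 'k::field) mpoly) set" where
  "free_module V r = {f. (\<forall>j<r. f j \<in> poly_ring V) \<and> (\<forall>j\<ge>r. f j = 0)}"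

definition mat_apply ::
    "nat \<Rightarrow> nat \<Rightarrow> (nat \<Rightarrow> nat \<Rightarrow> ('v, 'k::field) mpoly) \<Rightarrow> (nat \<Rightarrow> ('v, 'k) mpoly)
      \<Rightarrow> nat \<Rightarrow> ('v, 'k) mpoly" where
  "mat_apply r c A f = (\<lambda>k. if k < r then \<Sum>j<c. A k j * f j else 0)"

text \<open>A graded free resolution \<open>\<dots> \<rightarrow> F\<^sub>2 \<rightarrow> F\<^sub>1 \<rightarrow> F\<^sub>0 \<rightarrow> I \<rightarrow> 0\<close> of the ideal \<open>I\<close> of \<open>poly_ring V\<close>, as
  a graded module, by finitely generated free modules with chosen homogeneous bases:
  \<open>F\<^sub>i\<close> has rank \<open>r i\<close> and its \<open>j\<close>-th basis element has degree \<open>d i j\<close>; the augmentation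
  \<open>F\<^sub>0 \<rightarrow> I\<close> maps the \<open>j\<close>-th basis element to \<open>g j\<close>, and \<open>F\<^sub>i\<^sub>+\<^sub>1 \<rightarrow> F\<^sub>i\<close> has the
  matrix \<open>A i\<close>. The homogeneity conditions say that all maps preserve degrees.\<close>

definition graded_free_resolution ::
    "'v set \<Rightarrow> ('v, 'k::field) mpoly set \<Rightarrow> (nat \<Rightarrow> nat) \<Rightarrow> (nat \<Rightarrow> nat \<Rightarrow> int)
      \<Rightarrow> (nat \<Rightarrow> ('v, 'k) mpoly) \<Rightarrow> (nat \<Rightarrow> nat \<Rightarrow> nat \<Rightarrow> ('v, 'k) mpoly) \<Rightarrow> bool" where
  "graded_free_resolution V I r d g A \<longleftrightarrow>
     (\<forall>j<r 0. g j \<in> poly_ring V \<and> homogeneous (d 0 j) (g j)) \<and>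
     (\<forall>i. \<forall>k<r i. \<forall>j<r (Suc i).
        A i k j \<in> poly_ring V \<and> homogeneous (d (Suc i) j - d i k) (A i k j)) \<and>
     (\<lambda>f. \<Sum>j<r 0. f j * g j) ` free_module V (r 0) = I \<and>
     {f \<in> free_module V (r 0). (\<Sum>j<r 0. f j * g j) = 0} =
       mat_apply (r 0) (r 1) (A 0) ` free_module V (r 1) \<and>
     (\<forall>i. {f \<in> free_module V (r (Suc i)). mat_apply (r i) (r (Suc i)) (A i) f = (\<lambda>_. 0)} =
        mat_apply (r (Suc i)) (r (Suc (Suc i))) (A (Suc i)) ` free_module V (r (Suc (Suc i))))"

text \<open>Minimality: all matrix entries lie in the homogeneous maximal ideal, that is, they have
  constant term zero.\<close>

definition minimal_graded_free_resolution ::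
    "'v set \<Rightarrow> ('v, 'k::field) mpoly set \<Rightarrow> (nat \<Rightarrow> nat) \<Rightarrow> (nat \<Rightarrow> nat \<Rightarrow> int)
      \<Rightarrow> (nat \<Rightarrow> ('v, 'k) mpoly) \<Rightarrow> (nat \<Rightarrow> nat \<Rightarrow> nat \<Rightarrow> ('v, 'k) mpoly) \<Rightarrow> bool" where
  "minimal_graded_free_resolution V I r d g A \<longleftrightarrow>
     graded_free_resolution V I r d g A \<and>
     (\<forall>i. \<forall>k<r i. \<forall>j<r (Suc i). Poly_Mapping.lookup (A i k j) 0 = 0)"

text \<open>The regularity is the supremum of \<open>j - i\<close> over all \<open>i\<close>, \<open>j\<close> for which the \<open>i\<close>-th module of
  the minimal graded free resolution has a basis element of degree \<open>j\<close>. Every homogeneous ideal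
  for finite \<open>V\<close> has a minimal graded free resolution, and its ranks and degrees are unique up to
  order, so it does not matter that the supremum ranges over all of them. The zero ideal has
  regularity \<open>-\<infinity>\<close>.\<close>

definition regularity :: "'v set \<Rightarrow> ('v, 'k::field) mpoly set \<Rightarrow> ereal" where
  "regularity V I =
     Sup {ereal (real_of_int (d i j) - real i) | r d g A i j.
            minimal_graded_free_resolution V I r d g A \<and> j < r i}"

end

theory Submission
  imports Defs
begin

text \<open>
  Let \<open>R\<close> be the polynomial ring in the vertices and \<open>I\<close> the edge ideal. The vertex classes \<open>X\<close> and
  \<open>Y\<close> are vertex covers, and so are the at most \<open>2b\<close> vertices that meet a maximal matching with \<open>b\<close>
  edges. All three bounds are therefore cases of one: \<open>reg I\<^sup>s \<le> 2s + |C| - 1\<close> for every vertex cover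
  \<open>C\<close> (\<open>regularity_le_vertex_cover\<close>).

  The size of a vertex cover does not survive the induction on \<open>s\<close>, but a weaker quantity does. The
  stars at the points of \<open>C\<close> are chain graphs, that is, bipartite graphs without an induced pair of
  disjoint edges, so the graph is a union of \<open>m \<le> |C|\<close> chain graphs. For any union of \<open>m\<close> chain graphs
  \<open>reg R/I \<le> m\<close> (\<open>koszul_vanishes_chain_cover\<close>): in
  \<open>reg R/J \<le> max (reg R/(J : x) + 1) (reg R/(J + (x)))\<close> let \<open>x\<close> be a vertex with the largest
  neighbourhood in one of the chain graphs; the colon ideal contains all these neighbours, and that
  chain graph is gone.

  To pass from \<open>I\<^sup>s\<close> to \<open>I\<^sup>s\<^sup>+\<^sup>1\<close>, adjoin to \<open>I\<^sup>s\<^sup>+\<^sup>1\<close> the products \<open>u\<close> of \<open>s\<close> edges one by one, in decreasing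
  lexicographic order. Each colon ideal that occurs, of the ideal reached so far by \<open>u\<close>, is generated
  by some variables and by the edge ideal of the graph of all \<open>zz'\<close> for which \<open>zz'u\<close> is a product of
  \<open>s + 1\<close> edges (\<open>colon_lex_segment\<close>). Replacing \<open>u\<close> by \<open>abu\<close> with an edge \<open>ab\<close> adds to this graph
  exactly the pairs of a neighbour of \<open>b\<close> and a neighbour of \<open>a\<close> (\<open>linked_insert\<close>). A chain graph \<open>H\<close>
  stays a chain graph when the \<open>H\<close>-neighbours of \<open>b\<close> are joined to all neighbours of \<open>a\<close>, hence all
  these graphs are unions of \<open>m\<close> chain graphs (\<open>linked_chain_cover\<close>). As \<open>u\<close> has degree \<open>2s\<close>, this
  gives \<open>reg R/I\<^sup>s\<^sup>+\<^sup>1 \<le> max (reg R/I\<^sup>s) (2s + m)\<close> and then \<open>reg R/I\<^sup>s \<le> 2s + m - 2\<close> for \<open>s \<ge> 1\<close>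
  (\<open>koszul_vanishes_power\<close>). The combinatorics rests on following one alternating path between two
  products of edges (\<open>exchange\<close>).

  Regularity is controlled through the vanishing of the Koszul homology \<open>H\<^sub>p(R/J)\<^sub>d\<close> for
  \<open>d > p + reg R/J\<close>; for Koszul homology the estimate with \<open>J : x\<close> and \<open>J + (x)\<close> is a short diagram
  chase (\<open>koszul_vanishes_colon\<close>). The link to a minimal resolution of an ideal is dimension
  shifting along its syzygy modules: in every degree \<open>d > 0\<close> in which the \<open>i\<close>-th free module has a
  basis element, \<open>H\<^sub>i\<^sub>+\<^sub>1(R/J)\<^sub>d\<close> is not zero (\<open>no_generator_where_koszul_vanishes\<close>).
\<close>

section \<open>Monomial ideals and graded pieces\<close>

definition up_closed :: "('v \<Rightarrow>\<^sub>0 nat) set \<Rightarrow> bool" where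
  "up_closed A \<longleftrightarrow> (\<forall>m\<in>A. \<forall>l. l + m \<in> A)"

definition mon_ideal :: "'v set \<Rightarrow> ('v \<Rightarrow>\<^sub>0 nat) set \<Rightarrow> ('v, 'k::field) mpoly set" where
  "mon_ideal V A = {p \<in> poly_ring V. Poly_Mapping.keys p \<subseteq> A}"

definition hom_part :: "'v set \<Rightarrow> int \<Rightarrow> ('v, 'k::field) mpoly set" where
  "hom_part V d = {p \<in> poly_ring V. homogeneous d p}"

lemma keys_add_nat:
  fixes a b :: "'a \<Rightarrow>\<^sub>0 nat"
  shows "Poly_Mapping.keys (a + b) = Poly_Mapping.keys a \<union> Poly_Mapping.keys b"
  by (auto simp: in_keys_iff lookup_add)

lemma monom_degree_superset:
  assumes "finite W" "Poly_Mapping.keys m \<subseteq> W"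
  shows "monom_degree m = (\<Sum>v\<in>W. Poly_Mapping.lookup m v)"
  unfolding monom_degree_def
  by (rule sum.mono_neutral_left) (use assms in \<open>auto simp: in_keys_iff\<close>)

lemma monom_degree_add: "monom_degree (a + b) = monom_degree a + monom_degree b"
proof -
  let ?W = "Poly_Mapping.keys a \<union> Poly_Mapping.keys b"
  have "monom_degree (a + b) = (\<Sum>v\<in>?W. Poly_Mapping.lookup (a + b) v)"
    by (rule monom_degree_superset) (auto simp: keys_add_nat)
  also have "\<dots> = (\<Sum>v\<in>?W. Poly_Mapping.lookup a v) + (\<Sum>v\<in>?W. Poly_Mapping.lookup b v)"
    by (simp add: lookup_add sum.distrib)
  also have "\<dots> = monom_degree a + monom_degree b"
    using monom_degree_superset[of ?W a] monom_degree_superset[of ?W b] by simp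
  finally show ?thesis .
qed

lemma monom_degree_zero [simp]: "monom_degree 0 = 0"
  by (simp add: monom_degree_def)

lemma monom_degree_single [simp]: "monom_degree (Poly_Mapping.single v n) = n"
  by (simp add: monom_degree_def)

lemma monom_degree_eq_0_iff [simp]: "monom_degree m = 0 \<longleftrightarrow> m = 0"
proof
  assume "monom_degree m = 0"
  then have "\<forall>v\<in>Poly_Mapping.keys m. Poly_Mapping.lookup m v = 0"
    by (simp add: monom_degree_def)
  then have "Poly_Mapping.lookup m v = 0" for v
    by (cases "v \<in> Poly_Mapping.keys m") (auto simp: in_keys_iff)
  then show "m = 0" by (intro poly_mapping_eqI) simp
qed simp

lemma supported_add:
  assumes "\<forall>m\<in>Poly_Mapping.keys p. P m" "\<forall>m\<in>Poly_Mapping.keys q. P m"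
  shows "\<forall>m\<in>Poly_Mapping.keys (p + q). P m"
  using assms Poly_Mapping.keys_add[of p q] by blast

lemma supported_sum:
  assumes "\<And>i. i \<in> S \<Longrightarrow> \<forall>m\<in>Poly_Mapping.keys (f i). P m"
  shows "\<forall>m\<in>Poly_Mapping.keys (sum f S). P m"
  using assms Poly_Mapping.keys_sum[of f S] by blast

lemma keys_multE:
  assumes "m \<in> Poly_Mapping.keys (p * q)"
  obtains a b where "m = a + b" "a \<in> Poly_Mapping.keys p" "b \<in> Poly_Mapping.keys q"
  using assms keys_mult[of p q] by blast

lemma poly_ring_0 [simp, intro]: "0 \<in> poly_ring V"
  by (simp add: poly_ring_def)

lemma poly_ring_1 [simp, intro]: "1 \<in> poly_ring V"
  by (simp add: poly_ring_def)

lemma poly_ring_uminus [simp]: "- p \<in> poly_ring V \<longleftrightarrow> p \<in> poly_ring V"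
  by (simp add: poly_ring_def keys_minus)

lemma poly_ring_add [intro]: "p \<in> poly_ring V \<Longrightarrow> q \<in> poly_ring V \<Longrightarrow> p + q \<in> poly_ring V"
  unfolding poly_ring_def mem_Collect_eq by (rule supported_add)

lemma poly_ring_diff [intro]: "p \<in> poly_ring V \<Longrightarrow> q \<in> poly_ring V \<Longrightarrow> p - q \<in> poly_ring V"
  using poly_ring_add[of p V "- q"] by simp

lemma poly_ring_sum [intro]: "(\<And>i. i \<in> S \<Longrightarrow> f i \<in> poly_ring V) \<Longrightarrow> sum f S \<in> poly_ring V"
  unfolding poly_ring_def mem_Collect_eq by (rule supported_sum)

lemma poly_ring_mult [intro]: "p \<in> poly_ring V \<Longrightarrow> q \<in> poly_ring V \<Longrightarrow> p * q \<in> poly_ring V"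
  unfolding poly_ring_def by (force elim!: keys_multE simp: keys_add_nat)

lemma var_in_poly_ring [intro]: "v \<in> V \<Longrightarrow> var v \<in> poly_ring V"
  by (simp add: poly_ring_def var_def)

lemma mon_ideal_0 [simp, intro]: "0 \<in> mon_ideal V A"
  by (simp add: mon_ideal_def)

lemma mon_ideal_add [intro]: "p \<in> mon_ideal V A \<Longrightarrow> q \<in> mon_ideal V A \<Longrightarrow> p + q \<in> mon_ideal V A"
  unfolding mon_ideal_def using Poly_Mapping.keys_add[of p q] by auto

lemma mon_ideal_uminus [simp]: "- p \<in> mon_ideal V A \<longleftrightarrow> p \<in> mon_ideal V A"
  by (simp add: mon_ideal_def keys_minus)

lemma mon_ideal_diff [intro]: "p \<in> mon_ideal V A \<Longrightarrow> q \<in> mon_ideal V A \<Longrightarrow> p - q \<in> mon_ideal V A"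
  using mon_ideal_add[of p V A "- q"] by simp

lemma mon_ideal_sum [intro]:
  "(\<And>i. i \<in> S \<Longrightarrow> f i \<in> mon_ideal V A) \<Longrightarrow> sum f S \<in> mon_ideal V A"
  by (induction S rule: infinite_finite_induct) auto

lemma mon_ideal_mult:
  "up_closed A \<Longrightarrow> q \<in> poly_ring V \<Longrightarrow> p \<in> mon_ideal V A \<Longrightarrow> q * p \<in> mon_ideal V A"
proof -
  assume A: "up_closed A" and q: "q \<in> poly_ring V" and p: "p \<in> mon_ideal V A"
  have "m \<in> A" if m: "m \<in> Poly_Mapping.keys (q * p)" for m
    using m
  proof (rule keys_multE)
    fix a b assume "m = a + b" "b \<in> Poly_Mapping.keys p"
    then show "m \<in> A" using A p unfolding up_closed_def mon_ideal_def by blast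
  qed
  moreover have "q * p \<in> poly_ring V" using p q by (simp add: mon_ideal_def poly_ring_mult)
  ultimately show "q * p \<in> mon_ideal V A" by (auto simp: mon_ideal_def)
qed

lemma mon_ideal_mono: "A \<subseteq> B \<Longrightarrow> mon_ideal V A \<subseteq> mon_ideal V B"
  by (auto simp: mon_ideal_def)

lemma mon_ideal_empty [simp]: "mon_ideal V {} = {0}"
  unfolding mon_ideal_def by (auto simp only: subset_empty keys_eq_empty poly_ring_0)

lemma hom_part_0 [simp, intro]: "0 \<in> hom_part V d"
  by (simp add: hom_part_def homogeneous_def)

lemma hom_part_add [intro]: "p \<in> hom_part V d \<Longrightarrow> q \<in> hom_part V d \<Longrightarrow> p + q \<in> hom_part V d"
  unfolding hom_part_def homogeneous_def using Poly_Mapping.keys_add[of p q] by auto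

lemma hom_part_uminus [simp]: "- p \<in> hom_part V d \<longleftrightarrow> p \<in> hom_part V d"
  by (simp add: hom_part_def homogeneous_def keys_minus)

lemma hom_part_diff [intro]: "p \<in> hom_part V d \<Longrightarrow> q \<in> hom_part V d \<Longrightarrow> p - q \<in> hom_part V d"
  using hom_part_add[of p V d "- q"] by simp

lemma hom_part_sum [intro]:
  "(\<And>i. i \<in> S \<Longrightarrow> f i \<in> hom_part V d) \<Longrightarrow> sum f S \<in> hom_part V d"
  by (induction S rule: infinite_finite_induct) auto

lemma hom_part_mult:
  "p \<in> hom_part V d \<Longrightarrow> q \<in> hom_part V e \<Longrightarrow> p * q \<in> hom_part V (d + e)"
proof -
  assume p: "p \<in> hom_part V d" and q: "q \<in> hom_part V e"
  have "int (monom_degree m) = d + e" if m: "m \<in> Poly_Mapping.keys (p * q)" for m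
    using m
  proof (rule keys_multE)
    fix a b assume "m = a + b" "a \<in> Poly_Mapping.keys p" "b \<in> Poly_Mapping.keys q"
    then show ?thesis using p q unfolding hom_part_def homogeneous_def
      by (simp add: monom_degree_add)
  qed
  moreover have "p * q \<in> poly_ring V" using p q by (simp add: hom_part_def poly_ring_mult)
  ultimately show "p * q \<in> hom_part V (d + e)" by (simp add: hom_part_def homogeneous_def)
qed

lemma var_in_hom_part: "v \<in> V \<Longrightarrow> var v \<in> hom_part V 1"
  by (auto simp: hom_part_def homogeneous_def var_def poly_ring_def)

lemma hom_part_neg: "p \<in> hom_part V d \<Longrightarrow> d < 0 \<Longrightarrow> p = 0"
  using keys_eq_empty[of p] unfolding hom_part_def homogeneous_def by force

lemma hom_part_mon_degree: "p \<in> hom_part V d \<Longrightarrow> m \<in> Poly_Mapping.keys p \<Longrightarrow> int (monom_degree m) = d"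
  by (auto simp: hom_part_def homogeneous_def)

lemma keys_single_mult:
  fixes w :: "('v, 'k::field) mpoly"
  shows "Poly_Mapping.keys (Poly_Mapping.single f 1 * w) = (+) f ` Poly_Mapping.keys w"
proof -
  have *: "Poly_Mapping.lookup (Poly_Mapping.single f 1 * w) (f + m) = Poly_Mapping.lookup w m" for m
    by (simp add: lookup_mult lookup_single when_mult)
  show ?thesis
  proof (intro set_eqI iffI)
    fix m assume m: "m \<in> Poly_Mapping.keys (Poly_Mapping.single f 1 * w)"
    then obtain l where "m = f + l" by (rule keys_multE) auto
    with m * show "m \<in> (+) f ` Poly_Mapping.keys w" by (metis imageI in_keys_iff)
  next
    fix m assume "m \<in> (+) f ` Poly_Mapping.keys w"
    with * show "m \<in> Poly_Mapping.keys (Poly_Mapping.single f 1 * w)" by (metis imageE in_keys_iff)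
  qed
qed

lemma mpoly_expand: "p = (\<Sum>m\<in>Poly_Mapping.keys p. Poly_Mapping.single m (Poly_Mapping.lookup p m))"
proof (rule poly_mapping_eqI)
  fix k
  show "Poly_Mapping.lookup p k =
    Poly_Mapping.lookup (\<Sum>m\<in>Poly_Mapping.keys p. Poly_Mapping.single m (Poly_Mapping.lookup p m)) k"
    by (auto simp: lookup_sum lookup_single when_def in_keys_iff)
qed

definition multiples :: "('v \<Rightarrow>\<^sub>0 nat) \<Rightarrow> ('v \<Rightarrow>\<^sub>0 nat) set" where
  "multiples f = range (\<lambda>l. l + f)"

text \<open>For a monomial ideal \<open>I\<close> and a monomial \<open>f\<close>, put the terms of \<open>p \<in> I + (f)\<close> that lie in \<open>I\<close> into
  \<open>u\<close>, and divide the remaining ones by \<open>f\<close>. Terms are never combined, so if \<open>p\<close> is homogeneous then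
  so is \<open>w\<close>.\<close>

lemma mon_ideal_insert_split:
  fixes p :: "('v, 'k::field) mpoly"
  assumes "p \<in> mon_ideal V (A \<union> multiples f)" "p \<in> hom_part V d"
  obtains u w where "p = u + Poly_Mapping.single f 1 * w" "u \<in> mon_ideal V A"
    "w \<in> hom_part V (d - int (monom_degree f))"
proof -
  define u where "u = (\<Sum>m\<in>Poly_Mapping.keys p \<inter> A. Poly_Mapping.single m (Poly_Mapping.lookup p m))"
  define w where "w = (\<Sum>m\<in>Poly_Mapping.keys p - A. Poly_Mapping.single (m - f) (Poly_Mapping.lookup p m))"
  have V: "Poly_Mapping.keys m \<subseteq> V" if "m \<in> Poly_Mapping.keys p" for m
    using that assms(1) by (auto simp: mon_ideal_def poly_ring_def)
  have split: "m = f + (m - f)" if "m \<in> Poly_Mapping.keys p - A" for m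
    using that assms(1) by (auto simp: mon_ideal_def multiples_def add.commute)
  have "Poly_Mapping.single f 1 * w =
      (\<Sum>m\<in>Poly_Mapping.keys p - A. Poly_Mapping.single m (Poly_Mapping.lookup p m))"
    unfolding w_def sum_distrib_left
    by (rule sum.cong) (use split in \<open>auto simp: mult_single\<close>)
  moreover have "p = u + (\<Sum>m\<in>Poly_Mapping.keys p - A. Poly_Mapping.single m (Poly_Mapping.lookup p m))"
    unfolding u_def
    using mpoly_expand[of p] sum.Int_Diff[OF finite_keys, of "\<lambda>m. Poly_Mapping.single m (Poly_Mapping.lookup p m)" p A]
    by metis
  ultimately have 1: "p = u + Poly_Mapping.single f 1 * w" by metis
  have 2: "u \<in> mon_ideal V A"
    unfolding u_def by (rule mon_ideal_sum) (use V in \<open>auto simp: mon_ideal_def poly_ring_def\<close>)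
  have 3: "w \<in> hom_part V (d - int (monom_degree f))"
    unfolding w_def
  proof (rule hom_part_sum)
    fix m assume m: "m \<in> Poly_Mapping.keys p - A"
    have "int (monom_degree m) = d" using m assms(2) hom_part_mon_degree by blast
    moreover have "monom_degree m = monom_degree f + monom_degree (m - f)"
      using split[OF m] monom_degree_add by metis
    moreover have "Poly_Mapping.keys (m - f) \<subseteq> V"
      using V[of m] split[OF m] m keys_add_nat[of f "m - f"] by auto
    ultimately show "Poly_Mapping.single (m - f) (Poly_Mapping.lookup p m)
        \<in> hom_part V (d - int (monom_degree f))"
      by (auto simp: hom_part_def homogeneous_def poly_ring_def)
  qed
  show ?thesis by (rule that[OF 1 2 3])
qed

lemma single_mult_in_mon_ideal_iff:
  assumes "Poly_Mapping.keys f \<subseteq> V"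
  shows "Poly_Mapping.single f 1 * w \<in> mon_ideal V A \<longleftrightarrow> w \<in> mon_ideal V {m. f + m \<in> A}"
  using assms by (auto simp: mon_ideal_def poly_ring_def keys_single_mult keys_add_nat)

lemma single_mult_in_hom_part:
  assumes "Poly_Mapping.keys f \<subseteq> V" "w \<in> hom_part V (d - int (monom_degree f))"
  shows "Poly_Mapping.single f 1 * w \<in> hom_part V d"
  using assms
  by (auto simp: hom_part_def homogeneous_def poly_ring_def keys_single_mult keys_add_nat monom_degree_add)

section \<open>The Koszul complex\<close>

text \<open>The condition is \<open>f k l + f l k = 0\<close>, and the terms are cancelled in pairs: deducing only that the
  sum is its own negative would not suffice over a field of characteristic 2.\<close>

lemma sum_off_diagonal_alternating:
  fixes f :: "'a \<Rightarrow> 'a \<Rightarrow> 'b::comm_monoid_add"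
  assumes "finite A" "\<And>k l. k \<in> A \<Longrightarrow> l \<in> A \<Longrightarrow> k \<noteq> l \<Longrightarrow> f k l + f l k = 0"
  shows "(\<Sum>k\<in>A. \<Sum>l\<in>A - {k}. f k l) = 0"
  using assms
proof (induction A rule: finite_induct)
  case (insert a A)
  have "(\<Sum>l\<in>insert a A - {k}. f k l) = f k a + (\<Sum>l\<in>A - {k}. f k l)" if "k \<in> A" for k
  proof -
    have "insert a A - {k} = insert a (A - {k})" using that insert.hyps by auto
    then show ?thesis using insert.hyps by simp
  qed
  then have "(\<Sum>k\<in>insert a A. \<Sum>l\<in>insert a A - {k}. f k l)
      = (\<Sum>l\<in>A. f a l) + ((\<Sum>k\<in>A. f k a) + (\<Sum>k\<in>A. \<Sum>l\<in>A - {k}. f k l))"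
    using insert.hyps by (simp add: sum.distrib)
  also have "\<dots> = (\<Sum>l\<in>A. f a l + f l a)"
    using insert by (simp add: sum.distrib)
  also have "\<dots> = 0"
    by (rule sum.neutral) (use insert in auto)
  finally show ?case .
qed simp

text \<open>The exponents of the monomials in the ideal generated by the variables in \<open>D\<close>.\<close>

definition touching :: "'v set \<Rightarrow> ('v \<Rightarrow>\<^sub>0 nat) set" where
  "touching D = {m. Poly_Mapping.keys m \<inter> D \<noteq> {}}"

lemma up_closed_touching: "up_closed (touching D)"
  by (auto simp: up_closed_def touching_def keys_add_nat)

lemma multiples_single: "multiples (Poly_Mapping.single v 1) = touching {v}"
proof (intro set_eqI iffI)
  fix m assume "m \<in> touching {v}"
  then have "m = (m - Poly_Mapping.single v 1) + Poly_Mapping.single v 1"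
    by (intro poly_mapping_eqI) (auto simp: touching_def in_keys_iff lookup_add lookup_minus lookup_single when_def)
  then show "m \<in> multiples (Poly_Mapping.single v 1)" unfolding multiples_def by blast
qed (auto simp: touching_def multiples_def keys_add_nat)

text \<open>The numbering of the variables fixes the signs in the Koszul complex and the lexicographic order.\<close>

locale indexed_variables =
  fixes V :: "'v set" and idx :: "'v \<Rightarrow> nat"
  assumes finite_V: "finite V" and inj_idx: "inj_on idx V"
begin

definition koszul_sign :: "'v \<Rightarrow> 'v set \<Rightarrow> ('v, 'k::field) mpoly" where
  "koszul_sign k T = (-1) ^ card {j \<in> T. idx j < idx k}"

text \<open>A chain assigns to every set \<open>S\<close> of variables the coefficient of the basis element \<open>e\<^sub>S\<close> of the
  exterior algebra. For \<open>k\<close> in \<open>S\<close>, the differential of \<open>e\<^sub>S\<close> has the coefficient \<open>\<plusminus>k\<close> at \<open>S - {k}\<close>;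
  the formula collects the contributions to a fixed target \<open>T = S - {k}\<close>.\<close>

definition bd :: "('v set \<Rightarrow> ('v, 'k::field) mpoly) \<Rightarrow> 'v set \<Rightarrow> ('v, 'k) mpoly" where
  "bd c T = (\<Sum>k\<in>V - T. koszul_sign k T * var k * c (insert k T))"

definition wedge :: "'v \<Rightarrow> ('v set \<Rightarrow> ('v, 'k::field) mpoly) \<Rightarrow> 'v set \<Rightarrow> ('v, 'k) mpoly" where
  "wedge v w S = (if v \<in> S then koszul_sign v (S - {v}) * w (S - {v}) else 0)"

text \<open>The basis element \<open>e\<^sub>S\<close> has degree \<open>|S|\<close>, so that the coefficients of a chain of degree \<open>e\<close> have
  degree \<open>e - |S|\<close> and the differential preserves degrees.\<close>

definition koszul_chains :: "nat \<Rightarrow> int \<Rightarrow> ('v set \<Rightarrow> ('v, 'k::field) mpoly) set" where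
  "koszul_chains p e = {c. \<forall>S. if S \<subseteq> V \<and> card S = p then c S \<in> hom_part V (e - int p) else c S = 0}"

lemma finite_subV: "S \<subseteq> V \<Longrightarrow> finite S"
  using finite_V by (rule rev_finite_subset)

lemma sg_sq: "koszul_sign k T * koszul_sign k T = 1"
  by (simp add: koszul_sign_def flip: power_add mult_2)

lemma sg_cases: "koszul_sign k T = (1 :: ('v, 'k::field) mpoly) \<or> koszul_sign k T = (-1 :: ('v, 'k) mpoly)"
  unfolding koszul_sign_def by (cases "even (card {j \<in> T. idx j < idx k})") auto

lemma sg_hom: "koszul_sign k T \<in> hom_part V 0"
proof -
  have "(1 :: ('v, 'a) mpoly) \<in> hom_part V 0" by (simp add: hom_part_def homogeneous_def)
  then show ?thesis using sg_cases[of k T] by (metis hom_part_uminus)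
qed

lemma sg_poly_ring: "koszul_sign k T \<in> poly_ring V"
  using sg_hom by (auto simp: hom_part_def)

text \<open>Of two distinct variables, only the one with the larger index sees the other in front of it, and this
  changes exactly one of the four signs.\<close>

lemma sg_insert_swap:
  assumes "k \<in> V" "l \<in> V" "k \<noteq> l" "k \<notin> T" "l \<notin> T" "finite T"
  shows "koszul_sign k T * koszul_sign l (insert k T) = - (koszul_sign l T * koszul_sign k (insert l T) :: ('v, 'k::field) mpoly)"
proof -
  have main: "(koszul_sign l (insert k T) :: ('v, 'k) mpoly) = - koszul_sign l T \<and> (koszul_sign k (insert l T) :: ('v, 'k) mpoly) = koszul_sign k T"
    if "idx k < idx l" "k \<notin> T" for k l
  proof -
    have "{j \<in> insert k T. idx j < idx l} = insert k {j \<in> T. idx j < idx l}"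
      "{j \<in> insert l T. idx j < idx k} = {j \<in> T. idx j < idx k}" using that by auto
    then show ?thesis using that \<open>finite T\<close> by (simp add: koszul_sign_def)
  qed
  have "idx k \<noteq> idx l" using assms inj_idx by (auto dest: inj_onD)
  then consider "idx k < idx l" | "idx l < idx k" by linarith
  then show ?thesis
    by cases (use main[of k l] main[of l k] assms in \<open>auto simp: mult.commute\<close>)
qed

lemma chainsI:
  assumes "\<And>S. S \<subseteq> V \<Longrightarrow> card S = p \<Longrightarrow> c S \<in> hom_part V (e - int p)"
    "\<And>S. \<not> (S \<subseteq> V \<and> card S = p) \<Longrightarrow> c S = 0"
  shows "c \<in> koszul_chains p e"
  using assms by (auto simp: koszul_chains_def)

lemma chains_hom: "c \<in> koszul_chains p e \<Longrightarrow> c S \<in> hom_part V (e - int p)"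
  by (auto simp: koszul_chains_def dest: spec[of _ S] split: if_splits)

lemma chains_zero: "c \<in> koszul_chains p e \<Longrightarrow> \<not> (S \<subseteq> V \<and> card S = p) \<Longrightarrow> c S = 0"
  by (auto simp: koszul_chains_def dest: spec[of _ S] split: if_splits)

lemma chains_0 [simp]: "(\<lambda>_. 0) \<in> koszul_chains p e"
  by (auto simp: koszul_chains_def)

lemma chains_add:
  assumes "a \<in> koszul_chains p e" "b \<in> koszul_chains p e" shows "(\<lambda>S. a S + b S) \<in> koszul_chains p e"
  by (rule chainsI) (use assms in \<open>auto intro: chains_hom simp: chains_zero\<close>)

lemma chains_diff:
  assumes "a \<in> koszul_chains p e" "b \<in> koszul_chains p e" shows "(\<lambda>S. a S - b S) \<in> koszul_chains p e"
  by (rule chainsI) (use assms in \<open>auto intro: chains_hom simp: chains_zero\<close>)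

lemma chains_single_mult:
  assumes "Poly_Mapping.keys f \<subseteq> V" "w \<in> koszul_chains p (e - int (monom_degree f))"
  shows "(\<lambda>S. Poly_Mapping.single f 1 * w S) \<in> koszul_chains p e"
proof (rule chainsI)
  fix S assume "S \<subseteq> V" "card S = p"
  show "Poly_Mapping.single f 1 * w S \<in> hom_part V (e - int p)"
  proof (rule single_mult_in_hom_part[OF assms(1)])
    have "e - int p - int (monom_degree f) = e - int (monom_degree f) - int p" by simp
    then show "w S \<in> hom_part V (e - int p - int (monom_degree f))"
      using chains_hom[OF assms(2), of S] by metis
  qed
qed (simp add: chains_zero[OF assms(2)])

lemma bd_add: "bd (\<lambda>S. a S + b S) T = bd a T + bd b T"
  by (simp add: bd_def algebra_simps sum.distrib)

lemma bd_diff: "bd (\<lambda>S. a S - b S) T = bd a T - bd b T"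
  by (simp add: bd_def algebra_simps sum_subtractf)

lemma bd_mult: "bd (\<lambda>S. f * a S) T = f * bd a T"
  by (simp add: bd_def sum_distrib_left algebra_simps)

lemma bd_sum: "bd (\<lambda>S. \<Sum>i\<in>I. a i S) T = (\<Sum>i\<in>I. bd (a i) T)"
  by (induction I rule: infinite_finite_induct) (simp_all add: bd_add, simp_all add: bd_def)

lemma bd_chains:
  assumes c: "c \<in> koszul_chains (Suc p) e" shows "bd c \<in> koszul_chains p e"
proof (rule chainsI)
  fix S assume "S \<subseteq> V" "card S = p"
  show "bd c S \<in> hom_part V (e - int p)" unfolding bd_def
  proof (rule hom_part_sum)
    fix k assume "k \<in> V - S"
    then have "koszul_sign k S * var k * c (insert k S) \<in> hom_part V (0 + 1 + (e - int (Suc p)))"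
      by (intro hom_part_mult sg_hom var_in_hom_part chains_hom[OF c]) auto
    then show "koszul_sign k S * var k * c (insert k S) \<in> hom_part V (e - int p)" by (simp add: algebra_simps)
  qed
next
  fix S assume S: "\<not> (S \<subseteq> V \<and> card S = p)"
  have "c (insert k S) = 0" if "k \<in> V - S" for k
  proof (rule chains_zero[OF c], rule notI)
    assume *: "insert k S \<subseteq> V \<and> card (insert k S) = Suc p"
    then have "finite S" using finite_subset[OF _ finite_V, of S] by blast
    then have "card (insert k S) = Suc (card S)" using that by (intro card_insert_disjoint) blast+
    then show False using * S by auto
  qed
  then show "bd c S = 0" by (simp add: bd_def)
qed

lemma bd_bd:
  fixes c :: "'v set \<Rightarrow> ('v, 'k::field) mpoly"
  assumes "\<And>S. \<not> S \<subseteq> V \<Longrightarrow> c S = 0"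
  shows "bd (bd c) T = 0"
proof (cases "T \<subseteq> V")
  case True
  then have T: "finite T" using finite_subV by blast
  define f where "f k l = koszul_sign k T * var k * (koszul_sign l (insert k T) * var l * c (insert l (insert k T)))" for k l
  have "V - insert k T = (V - T) - {k}" for k by auto
  then have "bd (bd c) T = (\<Sum>k\<in>V - T. \<Sum>l\<in>(V - T) - {k}. f k l)"
    by (simp add: bd_def sum_distrib_left f_def)
  also have "\<dots> = 0"
  proof (rule sum_off_diagonal_alternating)
    fix k l assume kl: "k \<in> V - T" "l \<in> V - T" "k \<noteq> l"
    have "f k l = (koszul_sign k T * koszul_sign l (insert k T)) * (var k * var l * c (insert l (insert k T)))"
      by (simp add: f_def algebra_simps)
    also have "koszul_sign k T * koszul_sign l (insert k T) = - (koszul_sign l T * koszul_sign k (insert l T) :: ('v, 'k) mpoly)"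
      using kl T by (intro sg_insert_swap) auto
    also have "\<dots> * (var k * var l * c (insert l (insert k T))) = - f l k"
      by (simp add: f_def algebra_simps insert_commute)
    finally show "f k l + f l k = 0" by simp
  qed (simp add: finite_V)
  finally show ?thesis .
next
  case False
  then have "c (insert l (insert k T)) = 0" for k l using assms by simp
  then show ?thesis by (simp add: bd_def)
qed

lemma bd_bd_chains: "c \<in> koszul_chains p e \<Longrightarrow> bd (bd c) T = 0"
  by (rule bd_bd) (use chains_zero in blast)

lemma wedge_chains:
  assumes v: "v \<in> V" and w: "w \<in> koszul_chains p (e - 1)"
  shows "wedge v w \<in> koszul_chains (Suc p) e"
proof (rule chainsI)
  fix S
  have "koszul_sign v (S - {v}) * w (S - {v}) \<in> hom_part V (0 + (e - 1 - int p))"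
    by (intro hom_part_mult sg_hom chains_hom[OF w])
  then show "wedge v w S \<in> hom_part V (e - int (Suc p))"
    by (auto simp: wedge_def algebra_simps)
next
  fix S assume S: "\<not> (S \<subseteq> V \<and> card S = Suc p)"
  show "wedge v w S = 0"
  proof (cases "v \<in> S")
    case True
    have ne: "\<not> (S - {v} \<subseteq> V \<and> card (S - {v}) = p)"
    proof
      assume *: "S - {v} \<subseteq> V \<and> card (S - {v}) = p"
      then have "finite (S - {v})" using finite_subV by blast
      then have "card S = Suc p" using * True card_Suc_Diff1[of S v] by simp
      then show False using * v S by auto
    qed
    then show ?thesis by (simp add: wedge_def chains_zero[OF w ne])
  qed (simp add: wedge_def)
qed

text \<open>Exterior multiplication by \<open>e\<^sub>v\<close> is a homotopy from multiplication by \<open>v\<close> to zero. Hence variables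
  annihilate Koszul homology.\<close>

lemma bd_wedge:
  fixes w :: "'v set \<Rightarrow> ('v, 'k::field) mpoly"
  assumes v: "v \<in> V" and w: "\<And>S. \<not> S \<subseteq> V \<Longrightarrow> w S = 0"
  shows "bd (wedge v w) T + wedge v (bd w) T = var v * w T"
proof (cases "T \<subseteq> V")
  case False
  have "wedge v w (insert k T) = 0" for k
  proof -
    have "\<not> insert k T - {v} \<subseteq> V" using False v by blast
    then show ?thesis by (simp add: wedge_def w)
  qed
  moreover have "wedge v (bd w) T = 0"
  proof -
    have "w (insert k (T - {v})) = 0" for k by (rule w) (use False v in blast)
    then show ?thesis by (simp add: wedge_def bd_def)
  qed
  ultimately show ?thesis using w[OF False] by (simp add: bd_def)
next
  case True
  then have T: "finite T" using finite_subV by blast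
  show ?thesis
  proof (cases "v \<in> T")
    case False
    have "bd (wedge v w) T = (\<Sum>k\<in>V - T. if k = v then koszul_sign v T * var v * (koszul_sign v T * w T) else 0)"
      unfolding bd_def by (rule sum.cong) (use False in \<open>auto simp: wedge_def\<close>)
    also have "\<dots> = (koszul_sign v T * koszul_sign v T) * (var v * w T)"
      using False v finite_V by (simp add: algebra_simps)
    finally show ?thesis using False by (simp add: sg_sq wedge_def)
  next
    case True
    define T' where "T' = T - {v}"
    have T': "T = insert v T'" "v \<notin> T'" "finite T'" using True T by (auto simp: T'_def)
    have "wedge v (bd w) T = (\<Sum>k\<in>V - T'. koszul_sign v T' * (koszul_sign k T' * var k * w (insert k T')))"
      using T' by (simp add: wedge_def bd_def sum_distrib_left)
    also have "V - T' = insert v (V - T)" using T' v by auto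
    also have "(\<Sum>k\<in>insert v (V - T). koszul_sign v T' * (koszul_sign k T' * var k * w (insert k T')))
      = (koszul_sign v T' * koszul_sign v T') * (var v * w T) + (\<Sum>k\<in>V - T. koszul_sign v T' * (koszul_sign k T' * var k * w (insert k T')))"
      using T' finite_V by (simp add: algebra_simps)
    finally have 1: "wedge v (bd w) T
      = var v * w T + (\<Sum>k\<in>V - T. koszul_sign v T' * (koszul_sign k T' * var k * w (insert k T')))"
      by (simp add: sg_sq)
    have "bd (wedge v w) T = (\<Sum>k\<in>V - T. - (koszul_sign v T' * (koszul_sign k T' * var k * w (insert k T'))))"
      unfolding bd_def
    proof (rule sum.cong[OF refl])
      fix k assume k: "k \<in> V - T"
      then have "insert k T - {v} = insert k T'" using T' by auto
      then have "koszul_sign k T * var k * wedge v w (insert k T)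
          = (koszul_sign k (insert v T') * koszul_sign v (insert k T')) * (var k * w (insert k T'))"
        using T' by (simp add: wedge_def algebra_simps)
      also have "koszul_sign k (insert v T') * koszul_sign v (insert k T') = - (koszul_sign v T' * koszul_sign k T' :: ('v, 'k) mpoly)"
      proof -
        have "koszul_sign v T' * koszul_sign k (insert v T') = - (koszul_sign k T' * koszul_sign v (insert k T') :: ('v, 'k) mpoly)"
          using k v T' by (intro sg_insert_swap) auto
        note swap = this
        have "koszul_sign k (insert v T') * koszul_sign v (insert k T')
            = (koszul_sign v T' * koszul_sign v T') * (koszul_sign k (insert v T') * koszul_sign v (insert k T') :: ('v, 'k) mpoly)"
          by (simp add: sg_sq)
        also have "\<dots> = (koszul_sign v T' * koszul_sign k (insert v T')) * (koszul_sign v T' * koszul_sign v (insert k T'))"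
          by (simp only: ac_simps)
        also have "\<dots> = - (koszul_sign v T' * koszul_sign k T') * (koszul_sign v (insert k T') * koszul_sign v (insert k T'))"
          unfolding swap by (simp add: ac_simps)
        finally show ?thesis by (simp add: sg_sq)
      qed
      finally show "koszul_sign k T * var k * wedge v w (insert k T) = - (koszul_sign v T' * (koszul_sign k T' * var k * w (insert k T')))"
        by (simp add: algebra_simps)
    qed
    then show ?thesis using 1 by (simp add: sum_negf)
  qed
qed

text \<open>For an ideal \<open>I\<close> this says that the Koszul homology \<open>H\<^sub>p(R/I)\<close> vanishes in degree \<open>d\<close>. Chains of
  \<open>R/I\<close> are represented by chains of \<open>R\<close>.\<close>

definition koszul_vanishes :: "('v, 'k::field) mpoly set \<Rightarrow> nat \<Rightarrow> int \<Rightarrow> bool" where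
  "koszul_vanishes I p d \<longleftrightarrow>
     (\<forall>c\<in>koszul_chains p d. (\<forall>S. bd c S \<in> I) \<longrightarrow> (\<exists>b\<in>koszul_chains (Suc p) d. \<forall>S. c S - bd b S \<in> I))"

lemma koszul_vanishesE:
  assumes "koszul_vanishes I p d" "c \<in> koszul_chains p d" "\<And>S. bd c S \<in> I"
  obtains b where "b \<in> koszul_chains (Suc p) d" "\<And>S. c S - bd b S \<in> I"
  using assms unfolding koszul_vanishes_def by blast

lemma bd_in_mon_ideal:
  assumes "up_closed A" "\<And>S. u S \<in> mon_ideal V A"
  shows "bd u S \<in> mon_ideal V A"
  unfolding bd_def
  by (intro mon_ideal_sum mon_ideal_mult assms poly_ring_mult sg_poly_ring var_in_poly_ring) auto

lemma chains_split:
  fixes z :: "'v set \<Rightarrow> ('v, 'k::field) mpoly"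
  assumes z: "z \<in> koszul_chains p d" and zA: "\<And>S. z S \<in> mon_ideal V (A \<union> multiples f)"
  obtains u w where "\<And>S. z S = u S + Poly_Mapping.single f 1 * w S" "\<And>S. u S \<in> mon_ideal V A"
    "w \<in> koszul_chains p (d - int (monom_degree f))"
proof -
  have "\<exists>u w. z S = u + Poly_Mapping.single f 1 * w \<and> u \<in> mon_ideal V A \<and>
      (if S \<subseteq> V \<and> card S = p then w \<in> hom_part V (d - int (monom_degree f) - int p) else w = 0)" for S
  proof (cases "S \<subseteq> V \<and> card S = p")
    case True
    obtain u w where uw: "z S = u + Poly_Mapping.single f 1 * w" "u \<in> mon_ideal V A"
      "w \<in> hom_part V (d - int p - int (monom_degree f))"
      by (rule mon_ideal_insert_split[OF zA chains_hom[OF z]])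
    have "d - int p - int (monom_degree f) = d - int (monom_degree f) - int p" by simp
    then show ?thesis using uw True by metis
  next
    case False
    have "z S = 0 + Poly_Mapping.single f 1 * 0" using chains_zero[OF z False] by simp
    then show ?thesis using False by (metis mon_ideal_0)
  qed
  then obtain u w where "\<And>S. z S = u S + Poly_Mapping.single f 1 * w S \<and> u S \<in> mon_ideal V A \<and>
      (if S \<subseteq> V \<and> card S = p then w S \<in> hom_part V (d - int (monom_degree f) - int p) else w S = 0)"
    by metis
  then show ?thesis by (intro that[of u w]) (auto simp: koszul_chains_def)
qed

text \<open>The middle part of the long exact homology sequence of
  \<open>0 \<rightarrow> R/(I : f)(-deg f) \<rightarrow> R/I \<rightarrow> R/(I + (f)) \<rightarrow> 0\<close>. A cycle \<open>c\<close> modulo \<open>I\<close> is a boundary modulo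
  \<open>I + (f)\<close>, say \<open>c - \<partial>b = u + f w\<close> with \<open>u\<close> in \<open>I\<close>; then \<open>w\<close> is a cycle modulo \<open>I : f\<close>, and a chain
  bounding it corrects \<open>b\<close>.\<close>

theorem koszul_vanishes_colon:
  fixes A :: "('v \<Rightarrow>\<^sub>0 nat) set"
  assumes A: "up_closed A" and f: "Poly_Mapping.keys f \<subseteq> V"
    and colon: "koszul_vanishes (mon_ideal V {m. f + m \<in> A} :: ('v, 'k::field) mpoly set) p (d - int (monom_degree f))"
    and plus: "koszul_vanishes (mon_ideal V (A \<union> multiples f) :: ('v, 'k) mpoly set) p d"
  shows "koszul_vanishes (mon_ideal V A :: ('v, 'k) mpoly set) p d"
  unfolding koszul_vanishes_def
proof (intro ballI impI)
  fix c :: "'v set \<Rightarrow> ('v, 'k) mpoly"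
  let ?f = "Poly_Mapping.single f 1 :: ('v, 'k) mpoly"
  assume c: "c \<in> koszul_chains p d" and cA: "\<forall>S. bd c S \<in> mon_ideal V A"
  then have cA': "bd c S \<in> mon_ideal V (A \<union> multiples f)" for S
    using mon_ideal_mono[of A "A \<union> multiples f" V] by blast
  obtain b where b: "b \<in> koszul_chains (Suc p) d" and
    bA: "\<And>S. c S - bd b S \<in> mon_ideal V (A \<union> multiples f)"
    by (rule koszul_vanishesE[OF plus c cA']) blast
  obtain u w where uw: "\<And>S. c S - bd b S = u S + ?f * w S" and u: "\<And>S. u S \<in> mon_ideal V A"
    and w: "w \<in> koszul_chains p (d - int (monom_degree f))"
    by (rule chains_split[OF chains_diff[OF c bd_chains[OF b]] bA]) blast
  have bw: "bd w S \<in> mon_ideal V {m. f + m \<in> A}" for S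
  proof -
    have "?f * bd w S = bd (\<lambda>S. ?f * w S) S" by (simp add: bd_mult)
    also have "(\<lambda>S. ?f * w S) = (\<lambda>S. (c S - bd b S) - u S)" by (simp add: uw)
    also have "bd \<dots> S = bd c S - bd u S" by (simp add: bd_diff bd_bd_chains[OF b])
    also have "\<dots> \<in> mon_ideal V A"
      by (rule mon_ideal_diff[OF _ bd_in_mon_ideal[OF A]]) (use cA u in auto)
    finally show ?thesis using single_mult_in_mon_ideal_iff[OF f] by blast
  qed
  obtain b' where b': "b' \<in> koszul_chains (Suc p) (d - int (monom_degree f))"
    and b'A: "\<And>S. w S - bd b' S \<in> mon_ideal V {m. f + m \<in> A}"
    by (rule koszul_vanishesE[OF colon w bw]) blast
  show "\<exists>b\<in>koszul_chains (Suc p) d. \<forall>S. c S - bd b S \<in> mon_ideal V A"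
  proof (intro bexI allI)
    fix S
    have "c S - bd (\<lambda>S. b S + ?f * b' S) S = (c S - bd b S) - ?f * bd b' S"
      by (simp add: bd_add bd_mult)
    also have "\<dots> = u S + ?f * (w S - bd b' S)" by (simp add: uw algebra_simps)
    also have "\<dots> \<in> mon_ideal V A"
      using u b'A single_mult_in_mon_ideal_iff[OF f] by blast
    finally show "c S - bd (\<lambda>S. b S + ?f * b' S) S \<in> mon_ideal V A" .
  qed (intro chains_add b chains_single_mult f b')
qed

text \<open>An ideal generated by variables has regularity 0 as a quotient. If \<open>D\<close> is all of \<open>V\<close>, the positive
  degree \<open>d - p\<close> forces every coefficient into the ideal. Otherwise a variable \<open>v\<close> outside \<open>D\<close> is
  a nonzerodivisor modulo \<open>D\<close>, and the class that remains after passing to \<open>D \<union> {v}\<close> is a multiple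
  of \<open>v\<close>, which the homotopy \<open>bd_wedge\<close> kills.\<close>

lemma koszul_vanishes_variables:
  assumes "D \<subseteq> V" "int p < d"
  shows "koszul_vanishes (mon_ideal V (touching D) :: ('v, 'k::field) mpoly set) p d"
  using assms(1)
proof (induction "card (V - D)" arbitrary: D)
  case 0
  then have D: "D = V" using finite_V by auto
  show ?case unfolding koszul_vanishes_def
  proof (intro ballI impI bexI allI)
    fix c :: "'v set \<Rightarrow> ('v, 'k) mpoly" and S
    assume c: "c \<in> koszul_chains p d"
    have "m \<in> touching V" if m: "m \<in> Poly_Mapping.keys (c S)" for m
    proof -
      have "int (monom_degree m) = d - int p" using hom_part_mon_degree[OF chains_hom[OF c] m] .
      then have "m \<noteq> 0" using assms(2) by auto
      moreover have "Poly_Mapping.keys m \<subseteq> V"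
        using chains_hom[OF c, of S] m by (auto simp: hom_part_def poly_ring_def)
      ultimately show ?thesis by (simp add: touching_def Int_absorb2)
    qed
    then show "c S - bd (\<lambda>_. 0) S \<in> mon_ideal V (touching D)"
      using chains_hom[OF c, of S] D by (auto simp: mon_ideal_def hom_part_def bd_def)
  qed simp
next
  case (Suc n)
  then have "V - D \<noteq> {}" by force
  then obtain v where v: "v \<in> V" "v \<notin> D" by blast
  have "V - insert v D = V - D - {v}" by auto
  then have "n = card (V - insert v D)" using Suc.hyps(2) v finite_V by (simp add: card_Diff_singleton)
  then have IH: "koszul_vanishes (mon_ideal V (touching (insert v D)) :: ('v, 'k::field) mpoly set) p d"
    using Suc v by simp
  let ?m = "Poly_Mapping.single v 1 :: 'v \<Rightarrow>\<^sub>0 nat"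
  have un: "touching (insert v D) = touching D \<union> multiples ?m"
    unfolding multiples_single by (auto simp: touching_def)
  have nzd: "{m. ?m + m \<in> touching D} = touching D"
    using v by (auto simp: touching_def keys_add_nat)
  show ?case unfolding koszul_vanishes_def
  proof (intro ballI impI)
    fix c :: "'v set \<Rightarrow> ('v, 'k) mpoly"
    assume c: "c \<in> koszul_chains p d" and cA: "\<forall>S. bd c S \<in> mon_ideal V (touching D)"
    then have cA': "bd c S \<in> mon_ideal V (touching D \<union> multiples ?m)" for S
      using mon_ideal_mono[of "touching D" "touching D \<union> multiples ?m" V] by blast
    obtain b where b: "b \<in> koszul_chains (Suc p) d" and
      bA: "\<And>S. c S - bd b S \<in> mon_ideal V (touching D \<union> multiples ?m)"
      by (rule koszul_vanishesE[OF IH[unfolded un] c cA']) blast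
    obtain u w where uw: "\<And>S. c S - bd b S = u S + var v * w S" and u: "\<And>S. u S \<in> mon_ideal V (touching D)"
      and w: "w \<in> koszul_chains p (d - 1)"
    proof (rule chains_split[OF chains_diff[OF c bd_chains[OF b]] bA])
      fix u w
      assume "\<And>S. c S - bd b S = u S + Poly_Mapping.single ?m 1 * w S"
        "\<And>S. u S \<in> mon_ideal V (touching D)" "w \<in> koszul_chains p (d - int (monom_degree ?m))"
      then show thesis by (intro that[of u w]) (simp_all add: var_def)
    qed
    have bw: "bd w S \<in> mon_ideal V (touching D)" for S
    proof -
      have "var v * bd w S = bd (\<lambda>S. var v * w S) S" by (simp add: bd_mult)
      also have "(\<lambda>S. var v * w S) = (\<lambda>S. (c S - bd b S) - u S)" by (simp add: uw)
      also have "bd \<dots> S = bd c S - bd u S" by (simp add: bd_diff bd_bd_chains[OF b])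
      also have "\<dots> \<in> mon_ideal V (touching D)"
        by (rule mon_ideal_diff[OF _ bd_in_mon_ideal[OF up_closed_touching]]) (use cA u in auto)
      finally show ?thesis
        using single_mult_in_mon_ideal_iff[of ?m V "bd w S" "touching D"] v nzd by (simp add: var_def)
    qed
    show "\<exists>b\<in>koszul_chains (Suc p) d. \<forall>S. c S - bd b S \<in> mon_ideal V (touching D)"
    proof (intro bexI allI)
      fix S
      have "var v * w S = bd (wedge v w) S + wedge v (bd w) S"
        by (rule bd_wedge[symmetric]) (use v chains_zero[OF w] in auto)
      then have eq: "c S - bd (\<lambda>S. b S + wedge v w S) S = u S + wedge v (bd w) S"
        using uw[of S] by (simp add: bd_add algebra_simps)
      have "wedge v (bd w) S \<in> mon_ideal V (touching D)"
        unfolding wedge_def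
        by (cases "v \<in> S") (simp_all add: mon_ideal_mult[OF up_closed_touching sg_poly_ring bw])
      then show "c S - bd (\<lambda>S. b S + wedge v w S) S \<in> mon_ideal V (touching D)"
        unfolding eq using u by blast
    qed (intro chains_add b wedge_chains v w)
  qed
qed

lemma lookup_sg_mult:
  fixes q :: "('v, 'k::field) mpoly"
  shows "Poly_Mapping.lookup (koszul_sign k T * q) m = 0 \<longleftrightarrow> Poly_Mapping.lookup q m = 0"
  using sg_cases[of k T, where ?'k = 'k] by auto

lemma hom_part_0_single:
  assumes "q \<in> hom_part V 0" shows "q = Poly_Mapping.single 0 (Poly_Mapping.lookup q 0)"
proof (rule poly_mapping_eqI)
  fix m
  show "Poly_Mapping.lookup q m = Poly_Mapping.lookup (Poly_Mapping.single 0 (Poly_Mapping.lookup q 0)) m"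
    using hom_part_mon_degree[OF assms, of m] by (cases "m = 0") (auto simp: lookup_single in_keys_iff)
qed

text \<open>The Koszul complex of the polynomial ring resolves the residue field. For \<open>e > p\<close> this is
  the vanishing for the ideal generated by no variables. For \<open>e = p > 0\<close> the coefficients are constants
  \<open>\<alpha> S\<close>, and each of them appears as the coefficient of the monomial \<open>k \<in> S\<close> in the differential at
  \<open>S - {k}\<close>.\<close>

theorem koszul_exact:
  fixes c :: "'v set \<Rightarrow> ('v, 'k::field) mpoly"
  assumes c: "c \<in> koszul_chains p e" and cycle: "\<And>S. bd c S = 0"
    and const: "p = 0 \<Longrightarrow> Poly_Mapping.lookup (c {}) 0 = 0"
  obtains a where "a \<in> koszul_chains (Suc p) e" "\<And>S. bd a S = c S"
proof (cases "int p < e")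
  case True
  have "koszul_vanishes (mon_ideal V (touching {}) :: ('v, 'k) mpoly set) p e"
    by (rule koszul_vanishes_variables) (use True in auto)
  moreover have "touching {} = {}" by (auto simp: touching_def)
  ultimately obtain a where "a \<in> koszul_chains (Suc p) e" "\<And>S. c S - bd a S \<in> {0}"
    using c cycle unfolding koszul_vanishes_def by (metis mon_ideal_empty singletonI)
  then show ?thesis using that[of a] by simp
next
  case False
  have "c S = 0" for S
  proof (cases "S \<subseteq> V \<and> card S = p \<and> e = int p")
    case ne: False
    show ?thesis
    proof (cases "S \<subseteq> V \<and> card S = p")
      case True
      then have "e - int p < 0" using ne False by auto
      then show ?thesis by (rule hom_part_neg[OF chains_hom[OF c]])
    qed (rule chains_zero[OF c])
  next
    case S: True
    have hom: "c S' \<in> hom_part V 0" for S' using chains_hom[OF c, of S'] S by simp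
    define \<alpha> where "\<alpha> S' = Poly_Mapping.lookup (c S') 0" for S'
    have cS: "c S' = Poly_Mapping.single 0 (\<alpha> S')" for S'
      unfolding \<alpha>_def by (rule hom_part_0_single[OF hom])
    have "\<alpha> S = 0"
    proof (cases "p = 0")
      case True
      then have "S = {}" using S finite_subset[OF _ finite_V, of S] by simp
      then show ?thesis using const[OF True] by (simp add: \<alpha>_def)
    next
      case False
      then have "S \<noteq> {}" using S by (metis card.empty)
      then obtain k where k: "k \<in> S" by blast
      let ?T = "S - {k}"
      have ins: "insert k ?T = S" using k by blast
      have vc: "var l * c (insert l ?T) = Poly_Mapping.single (Poly_Mapping.single l 1) (\<alpha> (insert l ?T))" for l
        by (simp add: cS var_def mult_single)
      have l: "Poly_Mapping.lookup (var l * c (insert l ?T)) (Poly_Mapping.single k 1)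
          = (if l = k then \<alpha> S else 0)" for l
      proof -
        have "Poly_Mapping.single l (1::nat) = Poly_Mapping.single k 1 \<longleftrightarrow> l = k"
          by (metis lookup_single_eq lookup_single_not_eq zero_neq_one)
        then show ?thesis unfolding vc
          by (auto simp: lookup_single when_def insert_absorb[OF k])
      qed
      have "0 = Poly_Mapping.lookup (bd c ?T) (Poly_Mapping.single k 1)" by (simp only: cycle lookup_zero)
      also have "\<dots> = (\<Sum>l\<in>V - ?T. Poly_Mapping.lookup (koszul_sign l ?T * (var l * c (insert l ?T))) (Poly_Mapping.single k 1))"
        by (simp add: bd_def lookup_sum mult.assoc)
      also have "\<dots> = (\<Sum>l\<in>V - ?T. if l = k then Poly_Mapping.lookup (koszul_sign l ?T * (var l * c (insert l ?T))) (Poly_Mapping.single k 1) else 0)"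
      proof (rule sum.cong[OF refl])
        fix l
        have "Poly_Mapping.lookup (koszul_sign l ?T * (var l * c (insert l ?T))) (Poly_Mapping.single k 1) = 0"
          if "l \<noteq> k" using l[of l] that unfolding lookup_sg_mult by simp
        then show "Poly_Mapping.lookup (koszul_sign l ?T * (var l * c (insert l ?T))) (Poly_Mapping.single k 1)
          = (if l = k then Poly_Mapping.lookup (koszul_sign l ?T * (var l * c (insert l ?T))) (Poly_Mapping.single k 1) else 0)"
          by (cases "l = k") simp_all
      qed
      also have "\<dots> = Poly_Mapping.lookup (koszul_sign k ?T * (var k * c (insert k ?T))) (Poly_Mapping.single k 1)"
        using k S finite_V by (subst sum.delta) auto
      finally have "Poly_Mapping.lookup (var k * c (insert k ?T)) (Poly_Mapping.single k 1) = 0"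
        using lookup_sg_mult by metis
      then show ?thesis using l[of k] by simp
    qed
    then show ?thesis by (simp add: cS)
  qed
  then show ?thesis using that[of "\<lambda>_. 0"] by (simp add: bd_def)
qed

end

section \<open>Edge ideals of unions of chain graphs\<close>

text \<open>Bipartite graphs are sets of pairs, the first component on the left. In a chain graph the
  neighbourhoods of the left vertices form a chain under inclusion.\<close>

definition chain_graph :: "('v \<times> 'v) set \<Rightarrow> bool" where
  "chain_graph H \<longleftrightarrow> (\<forall>a b a' b'. (a, b) \<in> H \<longrightarrow> (a', b') \<in> H \<longrightarrow> (a, b') \<in> H \<or> (a', b) \<in> H)"

definition edge_monoms :: "('v \<times> 'v) set \<Rightarrow> ('v \<Rightarrow>\<^sub>0 nat) set" where
  "edge_monoms G = {m. \<exists>a b. (a, b) \<in> G \<and> a \<in> Poly_Mapping.keys m \<and> b \<in> Poly_Mapping.keys m}"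

lemma up_closed_Un: "up_closed A \<Longrightarrow> up_closed B \<Longrightarrow> up_closed (A \<union> B)"
  by (auto simp: up_closed_def)

lemma up_closed_edge_monoms: "up_closed (edge_monoms G)"
  unfolding up_closed_def edge_monoms_def by (force simp: keys_add_nat)

lemma chain_graph_dominating_vertex:
  assumes "finite H" "chain_graph H" "H \<noteq> {}"
  obtains x b where "(x, b) \<in> H" "\<And>a b. (a, b) \<in> H \<Longrightarrow> (x, b) \<in> H"
proof -
  define n where "n x = card (H `` {x})" for x
  have fin: "finite (H `` {x})" for x using assms(1) by (rule finite_Image)
  have "Max (n ` Domain H) \<in> n ` Domain H"
    using assms by (intro Max_in) (auto simp: finite_Domain)
  then obtain x where x: "x \<in> Domain H" "n x = Max (n ` Domain H)" by (metis imageE)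
  have "(x, b) \<in> H" if ab: "(a, b) \<in> H" for a b
  proof (rule ccontr)
    assume nb: "(x, b) \<notin> H"
    have "H `` {x} \<subseteq> H `` {a}"
      using assms(2) ab nb unfolding chain_graph_def by blast
    then have "H `` {x} \<subset> H `` {a}" using ab nb by blast
    then have "n x < n a" unfolding n_def by (rule psubset_card_mono[OF fin])
    moreover have "n a \<le> n x"
      unfolding x(2) using assms(1) ab by (intro Max_ge) (auto simp: finite_Domain)
    ultimately show False by simp
  qed
  moreover obtain b where "(x, b) \<in> H" using x by blast
  ultimately show ?thesis using that by blast
qed

lemma chain_graph_restrict: "chain_graph H \<Longrightarrow> chain_graph (H - D \<times> UNIV - UNIV \<times> D)"
  unfolding chain_graph_def by blast

context indexed_variables
begin

text \<open>The quotient by the edge ideal of a union of \<open>m\<close> chain graphs and by some variables has regularity at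
  most \<open>m\<close>. The graph itself never changes in the induction, only the set \<open>D\<close> of variables grows: edges
  that meet \<open>D\<close> are redundant, so a chain graph all of whose edges meet \<open>D\<close> can be dropped from the
  cover, which pays for the degree of \<open>x\<close> in the colon step.\<close>

theorem koszul_vanishes_chain_cover:
  assumes "finite HH" "\<And>H. H \<in> HH \<Longrightarrow> chain_graph H" "\<Union>HH \<subseteq> X \<times> Y" "X \<inter> Y = {}" "X \<union> Y \<subseteq> V"
    "D \<subseteq> V" "int p + int (card HH) < d"
  shows "koszul_vanishes (mon_ideal V (edge_monoms (\<Union>HH) \<union> touching D) :: ('v, 'k::field) mpoly set) p d"
  using assms
proof (induction "card (V - D)" arbitrary: D HH d rule: less_induct)
  case less
  show ?case
  proof (cases "\<exists>H\<in>HH. H - D \<times> UNIV - UNIV \<times> D \<noteq> {}")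
    case False
    then have "edge_monoms (\<Union>HH) \<union> touching D = touching D"
      unfolding edge_monoms_def touching_def by fastforce
    then show ?thesis using koszul_vanishes_variables[OF \<open>D \<subseteq> V\<close>, of p d] less.prems by simp
  next
    case True
    then obtain H where H: "H \<in> HH" and ne: "H - D \<times> UNIV - UNIV \<times> D \<noteq> {}" by blast
    have HV: "H \<subseteq> X \<times> Y" using H less.prems(3) by blast
    have "finite (V \<times> V)" using finite_V by simp
    then have "finite (H - D \<times> UNIV - UNIV \<times> D)"
      by (rule rev_finite_subset) (use HV less.prems(5) in auto)
    \<comment> \<open>With this choice of \<open>x\<close>, the variables in the colon ideal by \<open>x\<close> meet every edge of \<open>H\<close>.\<close>
    then obtain x y where xy: "(x, y) \<in> H - D \<times> UNIV - UNIV \<times> D"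
      and dom: "\<And>a b. (a, b) \<in> H - D \<times> UNIV - UNIV \<times> D \<Longrightarrow> (x, b) \<in> H - D \<times> UNIV - UNIV \<times> D"
      using chain_graph_dominating_vertex[OF _ chain_graph_restrict[OF less.prems(2)[OF H]] ne] by metis
    have x: "x \<in> X" "x \<notin> D" "x \<in> V" "x \<notin> Y" and y: "y \<in> V" "y \<notin> D"
      using xy HV less.prems by auto
    let ?G = "\<Union>HH"
    let ?A = "edge_monoms ?G \<union> touching D"
    let ?f = "Poly_Mapping.single x (1::nat)"
    define D' where "D' = D \<union> ?G `` {x}"
    have D': "D' \<subseteq> V" using less.prems unfolding D'_def by blast
    have keys_f: "Poly_Mapping.keys (?f + m) = insert x (Poly_Mapping.keys m)" for m
      by (simp add: keys_add_nat)
    have "{m. ?f + m \<in> ?A} = edge_monoms ?G \<union> touching D'"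
    proof (intro set_eqI iffI)
      fix m assume "m \<in> {m. ?f + m \<in> ?A}"
      then consider "?f + m \<in> touching D" | a b where "(a, b) \<in> ?G" "a \<in> insert x (Poly_Mapping.keys m)"
          "b \<in> insert x (Poly_Mapping.keys m)"
        using keys_f unfolding edge_monoms_def by blast
      then show "m \<in> edge_monoms ?G \<union> touching D'"
      proof cases
        case 1
        then show ?thesis using x keys_f[of m] unfolding touching_def D'_def by auto
      next
        case 2
        then have b: "b \<in> Poly_Mapping.keys m" using x less.prems(3) by blast
        show ?thesis
        proof (cases "a = x")
          case True
          then show ?thesis using b 2 unfolding touching_def D'_def by blast
        next
          case False
          then show ?thesis using b 2 unfolding edge_monoms_def by blast
        qed
      qed
    next
      fix m assume "m \<in> edge_monoms ?G \<union> touching D'"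
      then show "m \<in> {m. ?f + m \<in> ?A}"
        using keys_f[of m] unfolding edge_monoms_def touching_def D'_def by fastforce
    qed
    also have "\<dots> = edge_monoms (\<Union>(HH - {H})) \<union> touching D'"
    proof -
      have "a \<in> D' \<or> b \<in> D'" if "(a, b) \<in> H" for a b
        using dom[of a b] that H unfolding D'_def by blast
      then show ?thesis unfolding edge_monoms_def touching_def by blast
    qed
    finally have colon: "{m. ?f + m \<in> ?A} = edge_monoms (\<Union>(HH - {H})) \<union> touching D'" .
    have plus: "?A \<union> multiples ?f = edge_monoms ?G \<union> touching (insert x D)"
      unfolding multiples_single by (auto simp: touching_def)
    have card: "card (HH - {H}) + 1 = card HH"
      using H less.prems(1) by (metis Suc_eq_plus1 card_Suc_Diff1)
    have "y \<in> D'" using xy H unfolding D'_def by blast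
    then have "V - D' \<subset> V - D" using y unfolding D'_def by blast
    then have "card (V - D') < card (V - D)" by (intro psubset_card_mono) (simp_all add: finite_V)
    then have IH1: "koszul_vanishes (mon_ideal V (edge_monoms (\<Union>(HH - {H})) \<union> touching D') :: ('v, 'k) mpoly set) p (d - 1)"
      using less.prems D' card by (intro less.hyps) auto
    have "V - insert x D \<subset> V - D" using x by blast
    then have "card (V - insert x D) < card (V - D)" by (intro psubset_card_mono) (simp_all add: finite_V)
    then have IH2: "koszul_vanishes (mon_ideal V (edge_monoms ?G \<union> touching (insert x D)) :: ('v, 'k) mpoly set) p d"
      using less.prems x by (intro less.hyps) auto
    show ?thesis
      by (rule koszul_vanishes_colon[of _ ?f])
        (use IH1 IH2 colon plus x in \<open>simp_all add: up_closed_Un up_closed_edge_monoms up_closed_touching\<close>)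
  qed
qed

end

section \<open>Products of edges of a bipartite graph\<close>

definition expo :: "'v \<Rightarrow> 'v \<Rightarrow>\<^sub>0 nat" where
  "expo v = Poly_Mapping.single v 1"

lemma lookup_expo [simp]: "Poly_Mapping.lookup (expo v) w = (if v = w then 1 else 0)"
  by (simp add: expo_def lookup_single when_def)

lemma keys_expo [simp]: "Poly_Mapping.keys (expo v) = {v}"
  by (simp add: expo_def)

lemma monom_degree_expo [simp]: "monom_degree (expo v) = 1"
  by (simp add: expo_def)

text \<open>The exponents of the minimal generators of the \<open>s\<close>-th power of the edge ideal.\<close>

primrec edge_products :: "('v \<times> 'v) set \<Rightarrow> nat \<Rightarrow> ('v \<Rightarrow>\<^sub>0 nat) set" where
  "edge_products G 0 = {0}"
| "edge_products G (Suc s) = {expo a + expo b + g | a b g. (a, b) \<in> G \<and> g \<in> edge_products G s}"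

locale bipartite =
  fixes X Y :: "'v set" and G :: "('v \<times> 'v) set"
  assumes G_sub: "G \<subseteq> X \<times> Y" and disj: "X \<inter> Y = {}"
begin

abbreviation (input) prods where "prods \<equiv> edge_products G"

definition adj :: "'v \<Rightarrow> 'v \<Rightarrow> bool" where
  "adj z w \<longleftrightarrow> (z, w) \<in> G \<or> (w, z) \<in> G"

lemma adj_side: "adj z w \<Longrightarrow> w \<in> X \<longleftrightarrow> z \<notin> X"
  using G_sub disj by (auto simp: adj_def)

lemma prods_insert:
  assumes "adj z w" "g \<in> prods s"
  shows "expo z + expo w + g \<in> prods (Suc s)"
proof -
  have "expo z + expo w + g = expo w + expo z + g" by (simp add: add.commute)
  then show ?thesis using assms unfolding adj_def edge_products.simps by blast
qed

lemma prods_split: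
  "v \<in> prods s \<Longrightarrow> 0 < Poly_Mapping.lookup v z \<Longrightarrow>
    \<exists>w v' t. adj z w \<and> s = Suc t \<and> v = expo z + expo w + v' \<and> v' \<in> prods t"
proof (induction s arbitrary: v)
  case (Suc s)
  then obtain a b g where v: "v = expo a + expo b + g" "(a, b) \<in> G" "g \<in> prods s" by auto
  consider "z = a" | "z = b" | "z \<noteq> a" "z \<noteq> b" by blast
  then show ?case
  proof cases
    case 1
    then show ?thesis using v unfolding adj_def by blast
  next
    case 2
    then have "v = expo z + expo a + g" using v by (simp add: add.commute)
    then show ?thesis using 2 v unfolding adj_def by blast
  next
    case 3
    then have "0 < Poly_Mapping.lookup g z" using Suc.prems v by (simp add: lookup_add)
    then obtain w g' t where *: "adj z w" "s = Suc t" "g = expo z + expo w + g'" "g' \<in> prods t"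
      using Suc.IH v by blast
    then have "v = expo z + expo w + (expo a + expo b + g')" using v by (simp add: ac_simps)
    moreover have "expo a + expo b + g' \<in> prods s"
      unfolding * by (rule prods_insert) (use v * in \<open>auto simp: adj_def\<close>)
    ultimately show ?thesis using *(1) by blast
  qed
qed simp

lemma prods_keys: "u \<in> prods s \<Longrightarrow> Poly_Mapping.keys u \<subseteq> X \<union> Y"
proof (induction s arbitrary: u)
  case (Suc s)
  then obtain a b g where *: "u = expo a + expo b + g" "(a, b) \<in> G" "g \<in> prods s" by auto
  then show ?case using Suc.IH[of g] G_sub by (auto simp: keys_add_nat)
qed simp

lemma prods_degree: "u \<in> prods s \<Longrightarrow> monom_degree u = 2 * s"
  by (induction s arbitrary: u) (auto simp: monom_degree_add)

lemma finite_prods: "finite G \<Longrightarrow> finite (prods s)"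
proof (induction s)
  case (Suc s)
  have "prods (Suc s) \<subseteq> (\<lambda>((a, b), g). expo a + expo b + g) ` (G \<times> prods s)"
    by (auto simp: image_iff) force
  then show ?case using Suc by (meson finite_SigmaI finite_imageI finite_subset)
qed simp

text \<open>Starting at a vertex \<open>z\<close> that occurs more often in \<open>v\<close> than in \<open>u\<close>, walk along an edge of \<open>v\<close>, then
  an edge of \<open>u\<close>, and so on, always with edges not used before. The walk stops at the first vertex where
  this is impossible. If the last edge belongs to \<open>u\<close>, exchanging the edges along the walk replaces
  \<open>z'\<close> in \<open>u\<close> by \<open>z\<close>; if it belongs to \<open>v\<close>, the product \<open>u\<close> grows by the two ends. In the bipartite graph
  the side of the end vertex tells the two cases apart, and so in the second case \<open>z\<close> and \<open>z'\<close> are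
  different. The induction removes one edge from each of \<open>u\<close> and \<open>v\<close> and moves the start two steps
  along the walk.\<close>

theorem exchange:
  assumes "u \<in> prods s" "v \<in> prods t" "Poly_Mapping.lookup u z < Poly_Mapping.lookup v z"
  shows "(\<exists>z' u'. (z' \<in> X \<longleftrightarrow> z \<in> X) \<and> Poly_Mapping.lookup v z' < Poly_Mapping.lookup u z' \<and>
            u' \<in> prods s \<and> u' + expo z' = u + expo z) \<or>
         (\<exists>z'. (z' \<in> X \<longleftrightarrow> z \<notin> X) \<and> Poly_Mapping.lookup u z' < Poly_Mapping.lookup v z' \<and>
            u + expo z + expo z' \<in> prods (Suc s))"
  using assms
proof (induction s arbitrary: u v t z rule: less_induct)
  case (less s)
  let ?L = Poly_Mapping.lookup
  obtain w v' t' where v: "adj z w" "t = Suc t'" "v = expo z + expo w + v'" "v' \<in> prods t'"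
    using prods_split[OF less.prems(2), of z] less.prems(3) by auto
  have wX: "w \<in> X \<longleftrightarrow> z \<notin> X" by (rule adj_side[OF v(1)])
  show ?case
  proof (cases "?L u w < ?L v w")
    case True
    have "u + expo z + expo w = expo z + expo w + u" by (simp add: ac_simps)
    then have "u + expo z + expo w \<in> prods (Suc s)"
      using prods_insert[OF v(1) less.prems(1)] by metis
    then show ?thesis using wX True by blast
  next
    case False
    have "0 < ?L v w" using v by (simp add: lookup_add)
    then have "0 < ?L u w" using False by simp
    then obtain z2 u' s' where u: "adj w z2" "s = Suc s'" "u = expo w + expo z2 + u'" "u' \<in> prods s'"
      using prods_split[OF less.prems(1)] by blast
    have z2X: "z2 \<in> X \<longleftrightarrow> z \<in> X" using adj_side[OF u(1)] wX by blast
    have wz: "w \<noteq> z" "w \<noteq> z2" using wX z2X by blast+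
    show ?thesis
    proof (cases "?L v z2 < ?L u z2")
      case True
      have "expo z + expo w + u' \<in> prods s" unfolding u(2) by (rule prods_insert[OF v(1) u(4)])
      moreover have "expo z + expo w + u' + expo z2 = u + expo z" by (simp add: u(3) ac_simps)
      ultimately show ?thesis using z2X True by blast
    next
      case nd: False
      have Lv: "?L v y = ?L v' y + (if y = z then 1 else 0) + (if y = w then 1 else 0)" for y
        by (simp add: v(3) lookup_add)
      have Lu: "?L u y = ?L u' y + (if y = w then 1 else 0) + (if y = z2 then 1 else 0)" for y
        by (simp add: u(3) lookup_add)
      have "?L u' z2 < ?L v' z2"
        using nd less.prems(3) Lv[of z2] Lu[of z2] wz by (auto split: if_splits)
      from less.IH[OF _ u(4) v(4) this] u(2)
      consider (swap) z' u1 where "z' \<in> X \<longleftrightarrow> z2 \<in> X" "?L v' z' < ?L u' z'" "u1 \<in> prods s'"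
          "u1 + expo z' = u' + expo z2"
        | (grow) z' where "z' \<in> X \<longleftrightarrow> z2 \<notin> X" "?L u' z' < ?L v' z'" "u' + expo z2 + expo z' \<in> prods (Suc s')"
        by blast
      then show ?thesis
      proof cases
        case swap
        have "expo z + expo w + u1 \<in> prods s" unfolding u(2) by (rule prods_insert[OF v(1) swap(3)])
        moreover have "expo z + expo w + u1 + expo z' = u + expo z"
        proof -
          have "expo z + expo w + u1 + expo z' = expo z + expo w + (u1 + expo z')" by (simp add: ac_simps)
          also have "\<dots> = u + expo z" unfolding swap(4) by (simp add: u(3) ac_simps)
          finally show ?thesis .
        qed
        moreover have "?L v z' < ?L u z'"
          using swap(2) Lv[of z'] Lu[of z'] less.prems(3) by (auto split: if_splits)
        ultimately show ?thesis using swap(1) z2X by blast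
      next
        case grow
        have "u + expo z + expo z' = expo z + expo w + (u' + expo z2 + expo z')"
          by (simp add: u(3) ac_simps)
        then have "u + expo z + expo z' \<in> prods (Suc s)"
          using prods_insert[OF v(1) grow(3)] u(2) by metis
        moreover have "?L u z' < ?L v z'"
          using grow(1,2) Lv[of z'] Lu[of z'] z2X by (auto split: if_splits)
        ultimately show ?thesis using grow(1) z2X by blast
      qed
    qed
  qed
qed

corollary exchange_grow:
  assumes "u \<in> prods s" "v \<in> prods t" "Poly_Mapping.lookup u z < Poly_Mapping.lookup v z"
    "\<And>y. (y \<in> X \<longleftrightarrow> z \<in> X) \<Longrightarrow> Poly_Mapping.lookup u y \<le> Poly_Mapping.lookup v y"
  obtains z' where "z' \<in> X \<longleftrightarrow> z \<notin> X" "Poly_Mapping.lookup u z' < Poly_Mapping.lookup v z'"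
    "u + expo z + expo z' \<in> prods (Suc s)"
  using exchange[OF assms(1-3)]
proof (elim disjE exE conjE)
  fix z' u'
  assume "z' \<in> X \<longleftrightarrow> z \<in> X" "Poly_Mapping.lookup v z' < Poly_Mapping.lookup u z'"
  then show thesis using assms(4)[of z'] by simp
qed (rule that)

text \<open>Applying \<open>exchange\<close> to \<open>v\<close>, at a vertex where \<open>v\<close> falls short of \<open>u\<close>, reduces the total shortfall and
  does not create a new one. This is the analogue of the fact that augmenting paths keep covered vertices
  covered.\<close>

lemma prods_absorb:
  assumes "u \<in> prods s" "v \<in> prods t"
  shows "\<exists>v' t'. t \<le> t' \<and> v' \<in> prods t' \<and> (\<forall>z. Poly_Mapping.lookup u z \<le> Poly_Mapping.lookup v' z \<and>
     Poly_Mapping.lookup v' z \<le> max (Poly_Mapping.lookup u z) (Poly_Mapping.lookup v z))"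
  using assms(2)
proof (induction "\<Sum>z\<in>Poly_Mapping.keys u. Poly_Mapping.lookup u z - Poly_Mapping.lookup v z"
    arbitrary: v t rule: less_induct)
  case less
  let ?L = Poly_Mapping.lookup
  show ?case
  proof (cases "\<exists>z. ?L v z < ?L u z")
    case False
    then have "\<forall>z. ?L u z \<le> ?L v z" by (simp add: not_less)
    then show ?thesis using less.prems by (intro exI[of _ v] exI[of _ t]) simp
  next
    case True
    then obtain z where z: "?L v z < ?L u z" by blast
    have step: ?thesis if v1: "v1 \<in> prods t1" "t \<le> t1" and z1: "?L v z < ?L v1 z"
      and lo: "\<And>y. ?L u y - ?L v1 y \<le> ?L u y - ?L v y"
      and hi: "\<And>y. ?L v1 y \<le> max (?L u y) (?L v y)" for v1 t1
    proof -
      have zk: "z \<in> Poly_Mapping.keys u" using z by (simp add: in_keys_iff)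
      have "(\<Sum>z\<in>Poly_Mapping.keys u. ?L u z - ?L v1 z) < (\<Sum>z\<in>Poly_Mapping.keys u. ?L u z - ?L v z)"
      proof (rule sum_strict_mono_ex1)
        show "\<exists>y\<in>Poly_Mapping.keys u. ?L u y - ?L v1 y < ?L u y - ?L v y"
          using z z1 zk by (intro bexI[of _ z]) auto
      qed (use lo in auto)
      from less.hyps[OF this v1(1)] obtain v' t' where *: "t1 \<le> t'" "v' \<in> prods t'"
        "\<forall>z. ?L u z \<le> ?L v' z \<and> ?L v' z \<le> max (?L u z) (?L v1 z)" by blast
      have "?L v' y \<le> max (?L u y) (?L v y)" for y
        using *(3) hi[of y] by (metis max.bounded_iff max.cobounded1 order_trans)
      then show ?thesis using * v1(2) by (meson order_trans)
    qed
    from exchange[OF less.prems assms(1) z]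
    consider (swap) z' v1 where "?L u z' < ?L v z'" "v1 \<in> prods t" "v1 + expo z' = v + expo z"
      | (grow) z' where "z' \<in> X \<longleftrightarrow> z \<notin> X" "?L v z' < ?L u z'" "v + expo z + expo z' \<in> prods (Suc t)"
      by blast
    then show ?thesis
    proof cases
      case swap
      have L: "?L v1 y + (if z' = y then 1 else 0) = ?L v y + (if z = y then 1 else 0)" for y
        using arg_cong[OF swap(3), of "\<lambda>p. ?L p y"] by (simp add: lookup_add)
      have "z' \<noteq> z" using swap(1) z by auto
      show ?thesis
      proof (rule step[OF swap(2)])
        show "?L v z < ?L v1 z" using L[of z] \<open>z' \<noteq> z\<close> by simp
        show "?L u y - ?L v1 y \<le> ?L u y - ?L v y" for y
          using L[of y] swap(1) by (auto split: if_splits)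
        show "?L v1 y \<le> max (?L u y) (?L v y)" for y
          using L[of y] z by (auto split: if_splits)
      qed simp
    next
      case grow
      have L: "?L (v + expo z + expo z') y = ?L v y + (if z = y then 1 else 0) + (if z' = y then 1 else 0)" for y
        by (simp add: lookup_add)
      show ?thesis
      proof (rule step[OF grow(3)])
        show "?L (v + expo z + expo z') y \<le> max (?L u y) (?L v y)" for y
          unfolding L using z grow(1,2) by auto
      qed (auto simp: L)
    qed
  qed
qed

declare edge_products.simps(2) [simp del]

text \<open>The pairs that are joined by an alternating path with respect to \<open>u\<close>, also called even-connected
  pairs: multiplying \<open>u\<close> by both ends gives a product of one more edge.\<close>

definition linked :: "nat \<Rightarrow> ('v \<Rightarrow>\<^sub>0 nat) \<Rightarrow> ('v \<times> 'v) set" where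
  "linked s u = {(a, b) \<in> X \<times> Y. expo a + expo b + u \<in> prods (Suc s)}"

lemma linked_iff: "(a, b) \<in> linked s u \<longleftrightarrow> a \<in> X \<and> b \<in> Y \<and> expo a + expo b + u \<in> prods (Suc s)"
  by (simp only: linked_def mem_Collect_eq case_prod_conv mem_Sigma_iff conj_assoc)

lemma linkedI:
  assumes "z' \<in> X \<longleftrightarrow> z \<notin> X" "u + expo z + expo z' \<in> prods (Suc s)"
  shows "(z, z') \<in> linked s u \<or> (z', z) \<in> linked s u"
proof -
  have "z \<in> X \<union> Y" "z' \<in> X \<union> Y"
    using prods_keys[OF assms(2)] by (auto simp: keys_add_nat)
  moreover have "expo z + expo z' + u \<in> prods (Suc s)" "expo z' + expo z + u \<in> prods (Suc s)"
    using assms(2) by (simp_all add: ac_simps)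
  ultimately show ?thesis using assms(1) disj unfolding linked_def by blast
qed

text \<open>After \<open>v\<close> has absorbed \<open>u\<close>, there are no vertices with a shortfall left, so that \<open>exchange\<close> can only
  lead to its second alternative.\<close>

lemma augmenting_pair:
  assumes "u \<in> prods s" "v \<in> prods t" "s < t"
  obtains a b where "(a, b) \<in> linked s u" "Poly_Mapping.lookup u a < Poly_Mapping.lookup v a"
    "Poly_Mapping.lookup u b < Poly_Mapping.lookup v b"
proof -
  let ?L = Poly_Mapping.lookup
  obtain v' t' where v': "t \<le> t'" "v' \<in> prods t'" "\<And>z. ?L u z \<le> ?L v' z"
    "\<And>z. ?L v' z \<le> max (?L u z) (?L v z)"
    using prods_absorb[OF assms(1,2)] by blast
  have "u \<noteq> v'" using prods_degree[OF assms(1)] prods_degree[OF v'(2)] v'(1) assms(3) by auto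
  then obtain z where "?L u z \<noteq> ?L v' z" by (meson poly_mapping_eqI)
  then have z: "?L u z < ?L v' z" using v'(3)[of z] by simp
  obtain z' where z': "z' \<in> X \<longleftrightarrow> z \<notin> X" "?L u z' < ?L v' z'" "u + expo z + expo z' \<in> prods (Suc s)"
    by (rule exchange_grow[OF assms(1) v'(2) z v'(3)])
  have "?L u z < ?L v z" "?L u z' < ?L v z'"
    using z z'(2) v'(4)[of z] v'(4)[of z'] by auto
  then show ?thesis using linkedI[OF z'(1,3)] that by blast
qed

lemma prods_zero_linked: "linked 0 0 = G"
proof (intro set_eqI iffI)
  fix x assume "x \<in> linked 0 0"
  then obtain a b where x: "x = (a, b)" "a \<in> X" "b \<in> Y" and p: "expo a + expo b + 0 \<in> prods (Suc 0)"
    unfolding linked_def by blast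
  then obtain a' b' where G: "(a', b') \<in> G" and eq: "expo a + expo b + 0 = expo a' + expo b' + 0"
    unfolding edge_products.simps by blast
  have keys: "Poly_Mapping.keys (expo c + expo d + 0) = {c, d}" for c d :: 'v
    by (simp add: keys_add_nat insert_commute)
  have "{a, b} = {a', b'}" using keys[of a b] keys[of a' b'] unfolding eq by (rule trans[OF sym])
  moreover have b': "b' \<in> Y" using G G_sub by blast
  moreover have "a \<noteq> b'" using x(2) b' disj by blast
  ultimately have "a = a'" "b = b'" by (simp_all add: doubleton_eq_iff)
  then show "x \<in> G" using x G by simp
next
  fix x assume x: "x \<in> G"
  then obtain a b where ab: "x = (a, b)" "a \<in> X" "b \<in> Y" using G_sub by blast
  then have "expo a + expo b + 0 \<in> prods (Suc 0)"
    using x unfolding edge_products.simps by blast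
  then show "x \<in> linked 0 0" using ab unfolding linked_def by blast
qed

text \<open>For an edge \<open>ab\<close>, an alternating path with respect to \<open>abu\<close> either avoids the new edge or crosses it
  once, from \<open>b\<close> to \<open>a\<close>.\<close>

lemma linked_insert:
  assumes ab: "(a, b) \<in> G" and u: "u \<in> prods s"
  shows "linked (Suc s) (expo a + expo b + u) =
    linked s u \<union> {(z, z'). (z, b) \<in> linked s u \<and> (a, z') \<in> linked s u}"
    (is "?l = ?r")
proof (intro set_eqI iffI)
  let ?L = Poly_Mapping.lookup
  have adj: "adj a b" and abX: "a \<in> X" "b \<in> Y" "b \<notin> X" using ab G_sub disj by (auto simp: adj_def)
  fix x
  {
    assume "x \<in> ?l"
    then obtain z z' where x: "x = (z, z')" "z \<in> X" "z' \<in> Y"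
      and p: "expo z + expo z' + (expo a + expo b + u) \<in> prods (Suc (Suc s))"
      by (cases x) (auto simp only: linked_iff)
    let ?v = "expo z + expo z' + (expo a + expo b + u)"
    have zX: "z' \<notin> X" using x disj by blast
    have L: "?L ?v y = ?L u y + (if z = y then 1 else 0) + (if z' = y then 1 else 0) +
        (if a = y then 1 else 0) + (if b = y then 1 else 0)" for y
      by (simp add: lookup_add)
    \<comment> \<open>The product \<open>zz'abu\<close> contains \<open>u\<close>, so a path from \<open>z\<close> or from \<open>z'\<close> has to end at one of the four new vertices.\<close>
    have ex: "\<exists>y'. (y' \<in> X \<longleftrightarrow> y \<notin> X) \<and> y' \<in> {z, z', a, b} \<and> ((y, y') \<in> linked s u \<or> (y', y) \<in> linked s u)"
      if y: "y \<in> {z, z'}" for y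
    proof -
      have "?L u y < ?L ?v y" using y L[of y] by (auto split: if_splits)
      then obtain y' where y': "y' \<in> X \<longleftrightarrow> y \<notin> X" "?L u y' < ?L ?v y'" "u + expo y + expo y' \<in> prods (Suc s)"
        by (rule exchange_grow[OF u p]) (simp add: L)
      then have "y' \<in> {z, z', a, b}" using L[of y'] by (auto split: if_splits)
      then show ?thesis using y'(1) linkedI[OF y'(1,3)] by blast
    qed
    have lX: "p \<in> X \<and> q \<notin> X" if "(p, q) \<in> linked s u" for p q
      using that disj unfolding linked_def by blast
    have "(z, z') \<in> linked s u \<or> (z, b) \<in> linked s u"
      using ex[of z] lX x abX zX by blast
    moreover have "(z, z') \<in> linked s u \<or> (a, z') \<in> linked s u"
      using ex[of z'] lX x abX zX by blast
    ultimately show "x \<in> ?r" using x by blast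
  }
  {
    assume xr: "x \<in> ?r"
    obtain z z' where x: "x = (z, z')" by (cases x)
    have c: "(z, z') \<in> linked s u \<or> (z, b) \<in> linked s u \<and> (a, z') \<in> linked s u"
      using xr unfolding x by blast
    have zz: "z \<in> X" "z' \<in> Y" "z' \<notin> X" using c disj unfolding linked_def by blast+
    have direct: "(p, q) \<in> ?l" if "(p, q) \<in> linked s u" for p q
    proof -
      have "expo p + expo q + (expo a + expo b + u) = expo a + expo b + (expo p + expo q + u)"
        by (simp add: ac_simps)
      then have "expo p + expo q + (expo a + expo b + u) \<in> prods (Suc (Suc s))"
        using prods_insert[OF adj, of "expo p + expo q + u"] that unfolding linked_iff by simp
      then show ?thesis using that unfolding linked_iff by simp
    qed
    show "x \<in> ?l"
    proof (cases "(z, z') \<in> linked s u \<or> z = a \<or> z' = b")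
      case True
      then show ?thesis using c direct x by blast
    next
      case False
      let ?U = "expo z + expo b + u"
      let ?v = "expo a + expo b + (expo a + expo z' + u)"
      \<comment> \<open>Since \<open>?v\<close> contains all of \<open>?U\<close> except for one \<open>z\<close>, a path from \<open>z'\<close> can only end at the surplus vertex \<open>a\<close>.\<close>
      have U: "?U \<in> prods (Suc s)" using False c unfolding linked_def by blast
      have v: "?v \<in> prods (Suc (Suc s))"
        using prods_insert[OF adj, of "expo a + expo z' + u"] False c unfolding linked_def by blast
      have z'z: "z' \<noteq> z" "a \<noteq> b" "z' \<noteq> b" "z \<noteq> a" "z \<noteq> b" "a \<noteq> z'" using zz abX False by blast+
      have lt: "?L ?U z' < ?L ?v z'" using z'z by (simp add: lookup_add)
      have "?L ?U y \<le> ?L ?v y" if "y \<in> X \<longleftrightarrow> z' \<in> X" for y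
      proof -
        have "y \<noteq> z" using that zz by blast
        then show ?thesis by (simp add: lookup_add)
      qed
      from exchange_grow[OF U v lt this] obtain y where y: "y \<in> X" "?L ?U y < ?L ?v y"
        "?U + expo z' + expo y \<in> prods (Suc (Suc s))"
        using zz(3) by (metis (lifting))
      have "y \<noteq> z'" using y(1) zz by blast
      then have "y = a" using y(2) by (simp add: lookup_add split: if_splits)
      then have "expo z + expo z' + (expo a + expo b + u) \<in> prods (Suc (Suc s))"
        using y(3) by (simp add: ac_simps)
      then show ?thesis using x zz unfolding linked_def by blast
    qed
  }
qed

text \<open>A chain graph \<open>H\<close> of the cover is enlarged by all edges from \<open>H\<close>-neighbours of \<open>b\<close> to neighbours of \<open>a\<close>
  in the whole graph. The \<open>H\<close>-neighbours of \<open>b\<close> are an upper segment of the chain of neighbourhoods, and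
  adding the same vertices to all members of an upper segment preserves the chain.\<close>

lemma linked_chain_cover:
  assumes "u \<in> prods s" "finite HH" "\<And>H. H \<in> HH \<Longrightarrow> chain_graph H" "\<Union>HH = G"
  shows "\<exists>HH'. finite HH' \<and> card HH' \<le> card HH \<and> (\<forall>H\<in>HH'. chain_graph H) \<and> \<Union>HH' = linked s u"
  using assms(1)
proof (induction s arbitrary: u)
  case 0
  then have "linked 0 u = \<Union>HH" using prods_zero_linked assms(4) by simp
  then show ?case using assms(2,3) by (intro exI[of _ HH]) simp
next
  case (Suc s)
  from Suc.prems obtain a b u0 where u: "u = expo a + expo b + u0" "(a, b) \<in> G" "u0 \<in> prods s"
    unfolding edge_products.simps by blast
  obtain HH0 where HH0: "finite HH0" "card HH0 \<le> card HH" "\<And>H. H \<in> HH0 \<Longrightarrow> chain_graph H"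
    "\<Union>HH0 = linked s u0" using Suc.IH[OF u(3)] by blast
  define ext :: "('v \<times> 'v) set \<Rightarrow> ('v \<times> 'v) set" where "ext H = H \<union> {(z, z'). (z, b) \<in> H \<and> (a, z') \<in> linked s u0}" for H
  have "chain_graph (ext H)" if "H \<in> HH0" for H
    using HH0(3)[OF that] unfolding chain_graph_def ext_def by blast
  moreover have "\<Union>(ext ` HH0) = linked (Suc s) u"
    unfolding u(1) linked_insert[OF u(2,3)] HH0(4)[symmetric] ext_def by blast
  moreover have "card (ext ` HH0) \<le> card HH"
    using card_image_le[OF HH0(1), of ext] HH0(2) by linarith
  ultimately show ?case using HH0(1) by (intro exI[of _ "ext ` HH0"]) blast
qed

end

section \<open>Koszul homology of the powers\<close>

definition up_set :: "('v \<Rightarrow>\<^sub>0 nat) set \<Rightarrow> ('v \<Rightarrow>\<^sub>0 nat) set" where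
  "up_set B = (\<Union>g\<in>B. multiples g)"

lemma up_insert: "up_set (insert u B) = up_set B \<union> multiples u"
  by (auto simp: up_set_def)

lemma up_iff: "m \<in> up_set B \<longleftrightarrow> (\<exists>g\<in>B. \<exists>r. m = r + g)"
  unfolding up_set_def multiples_def by blast

lemma up_closed_up: "up_closed (up_set B)"
  unfolding up_closed_def
proof (intro ballI allI)
  fix m l assume "m \<in> up_set B"
  then obtain g r where "g \<in> B" "m = r + g" unfolding up_iff by blast
  then have "l + m = (l + r) + g" "g \<in> B" by (simp_all add: ac_simps)
  then show "l + m \<in> up_set B" unfolding up_iff by blast
qed

lemma in_multiples_iff: "m \<in> multiples f \<longleftrightarrow> (\<forall>v. Poly_Mapping.lookup f v \<le> Poly_Mapping.lookup m v)"
proof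
  assume "\<forall>v. Poly_Mapping.lookup f v \<le> Poly_Mapping.lookup m v"
  then have "m = (m - f) + f"
    by (intro poly_mapping_eqI) (simp add: lookup_add lookup_minus)
  then show "m \<in> multiples f" unfolding multiples_def by blast
qed (auto simp: multiples_def lookup_add)

lemma touchingI: "z \<in> D \<Longrightarrow> z \<in> Poly_Mapping.keys w \<Longrightarrow> w \<in> touching D"
  unfolding touching_def by blast

context indexed_variables
begin

definition lex_less :: "('v \<Rightarrow>\<^sub>0 nat) \<Rightarrow> ('v \<Rightarrow>\<^sub>0 nat) \<Rightarrow> bool" where
  "lex_less u v \<longleftrightarrow> (\<exists>z\<in>V. Poly_Mapping.lookup u z < Poly_Mapping.lookup v z \<and>
     (\<forall>y\<in>V. idx y < idx z \<longrightarrow> Poly_Mapping.lookup u y = Poly_Mapping.lookup v y))"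

lemma lex_less_trans:
  assumes "lex_less u v" "lex_less v w" shows "lex_less u w"
proof -
  obtain z z' where z: "z \<in> V" "Poly_Mapping.lookup u z < Poly_Mapping.lookup v z"
    "\<And>y. y \<in> V \<Longrightarrow> idx y < idx z \<Longrightarrow> Poly_Mapping.lookup u y = Poly_Mapping.lookup v y"
    and z': "z' \<in> V" "Poly_Mapping.lookup v z' < Poly_Mapping.lookup w z'"
    "\<And>y. y \<in> V \<Longrightarrow> idx y < idx z' \<Longrightarrow> Poly_Mapping.lookup v y = Poly_Mapping.lookup w y"
    using assms unfolding lex_less_def by blast
  consider "idx z < idx z'" | "idx z' < idx z" | "z = z'"
    using inj_idx z(1) z'(1) by (meson inj_onD linorder_less_linear)
  then show ?thesis
  proof cases
    case 1
    then show ?thesis using z z' unfolding lex_less_def by (intro bexI[of _ z]) auto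
  next
    case 2
    then show ?thesis using z z' unfolding lex_less_def by (intro bexI[of _ z']) auto
  next
    case 3
    then show ?thesis using z z' unfolding lex_less_def by (intro bexI[of _ z]) auto
  qed
qed

lemma lex_less_irrefl: "\<not> lex_less u u"
  by (simp add: lex_less_def)

lemma lex_less_total:
  assumes "Poly_Mapping.keys u \<subseteq> V" "Poly_Mapping.keys v \<subseteq> V" "u \<noteq> v"
  shows "lex_less u v \<or> lex_less v u"
proof -
  obtain y where y: "Poly_Mapping.lookup u y \<noteq> Poly_Mapping.lookup v y"
    using assms(3) by (meson poly_mapping_eqI)
  then have yV: "y \<in> V" using assms by (metis in_keys_iff subsetD)
  define P where "P z \<longleftrightarrow> z \<in> V \<and> Poly_Mapping.lookup u z \<noteq> Poly_Mapping.lookup v z" for z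
  have "P y" using y yV unfolding P_def by blast
  define z where "z = arg_min idx P"
  have z: "P z" "\<And>y. P y \<Longrightarrow> idx z \<le> idx y"
    unfolding z_def using arg_min_natI[of P, OF \<open>P y\<close>] arg_min_nat_le[of P _ idx] by auto
  have "Poly_Mapping.lookup u x = Poly_Mapping.lookup v x" if "x \<in> V" "idx x < idx z" for x
    using z(2)[of x] that unfolding P_def by force
  then show ?thesis using z(1) unfolding lex_less_def P_def by (metis linorder_neqE_nat)
qed

text \<open>Here variables with a smaller index dominate.\<close>

lemma lex_less_exchange:
  assumes "u' + expo z' = u + expo z" "z \<in> V" "idx z < idx z'"
  shows "lex_less u u'"
  unfolding lex_less_def
proof (intro bexI[of _ z] conjI ballI impI)
  have L: "Poly_Mapping.lookup u' y + (if z' = y then 1 else 0) = Poly_Mapping.lookup u y + (if z = y then 1 else 0)" for y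
    using arg_cong[OF assms(1), of "\<lambda>p. Poly_Mapping.lookup p y"] by (simp add: lookup_add)
  show "Poly_Mapping.lookup u z < Poly_Mapping.lookup u' z"
    using L[of z] assms(3) by (auto split: if_splits)
  show "Poly_Mapping.lookup u y = Poly_Mapping.lookup u' y" if "idx y < idx z" for y
    using L[of y] that assms(3) by (auto split: if_splits)
qed (rule assms)

end

locale bipartite_variables = indexed_variables V idx + bipartite X Y G
  for V :: "'v set" and idx and X Y :: "'v set" and G +
  assumes parts: "X \<union> Y \<subseteq> V"
begin

lemma finite_G: "finite G"
proof -
  have "finite (V \<times> V)" using finite_V by simp
  then show ?thesis by (rule rev_finite_subset) (use G_sub parts in blast)
qed

lemma prods_keys_V: "u \<in> prods s \<Longrightarrow> Poly_Mapping.keys u \<subseteq> V"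
  using prods_keys parts by blast

lemma colon_next_power:
  assumes u: "u \<in> prods s"
  shows "u + w \<in> up_set (prods (Suc s)) \<longleftrightarrow> w \<in> edge_monoms (linked s u)"
proof
  assume "u + w \<in> up_set (prods (Suc s))"
  then obtain v r where v: "v \<in> prods (Suc s)" "u + w = r + v" unfolding up_iff by blast
  have L: "Poly_Mapping.lookup u y + Poly_Mapping.lookup w y = Poly_Mapping.lookup r y + Poly_Mapping.lookup v y" for y
    using arg_cong[OF v(2), of "\<lambda>p. Poly_Mapping.lookup p y"] by (simp add: lookup_add)
  obtain a b where ab: "(a, b) \<in> linked s u" "Poly_Mapping.lookup u a < Poly_Mapping.lookup v a"
    "Poly_Mapping.lookup u b < Poly_Mapping.lookup v b"
    by (rule augmenting_pair[OF u v(1)]) auto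
  have "a \<in> Poly_Mapping.keys w" "b \<in> Poly_Mapping.keys w"
    using L[of a] L[of b] ab(2,3) by (simp_all add: in_keys_iff)
  then show "w \<in> edge_monoms (linked s u)" using ab(1) unfolding edge_monoms_def by blast
next
  assume "w \<in> edge_monoms (linked s u)"
  then obtain a b where ab: "(a, b) \<in> linked s u" "a \<in> Poly_Mapping.keys w" "b \<in> Poly_Mapping.keys w"
    unfolding edge_monoms_def by blast
  then have "a \<noteq> b" using disj unfolding linked_iff by blast
  then have "Poly_Mapping.lookup (expo a + expo b) y \<le> Poly_Mapping.lookup w y" for y
    using ab(2,3) by (auto simp: lookup_add in_keys_iff)
  then have "w \<in> multiples (expo a + expo b)" by (simp add: in_multiples_iff)
  then obtain r where "w = r + (expo a + expo b)" unfolding multiples_def by blast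
  then have "u + w = r + (expo a + expo b + u)" by (simp add: ac_simps)
  then show "u + w \<in> up_set (prods (Suc s))" using ab(1) unfolding up_iff linked_iff by blast
qed

text \<open>The set \<open>B\<close> consists of the products that are lexicographically larger than \<open>u\<close>. If \<open>uw\<close> is a multiple
  of some \<open>v \<in> B\<close>, then \<open>exchange\<close> is applied at the first variable \<open>z\<close> where \<open>u\<close> and \<open>v\<close> differ: a
  swap of \<open>z\<close> for a later variable \<open>z'\<close> leads to an element of \<open>B\<close> again, so that the single
  variable \<open>z\<close>, which divides \<open>w\<close>, lies in the colon ideal.\<close>

lemma colon_lex_segment:
  assumes u: "u \<in> prods s" and B: "B \<subseteq> prods s" "\<And>v. v \<in> B \<Longrightarrow> lex_less u v"
    and above: "\<And>v. v \<in> prods s \<Longrightarrow> lex_less u v \<Longrightarrow> v \<in> B"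
  shows "{w. u + w \<in> up_set (prods (Suc s)) \<union> up_set B} =
    edge_monoms (linked s u) \<union> touching {z \<in> V. \<exists>u'\<in>B. \<exists>z'. u' + expo z' = u + expo z}"
    (is "?l = ?e \<union> touching ?D")
proof (intro set_eqI iffI)
  let ?L = Poly_Mapping.lookup
  fix w assume w: "w \<in> ?l"
  show "w \<in> ?e \<union> touching ?D"
  proof (cases "u + w \<in> up_set (prods (Suc s))")
    case True
    then show ?thesis using colon_next_power[OF u, of w] by simp
  next
    case False
    then have "u + w \<in> up_set B" using w by blast
    then obtain v r where v: "v \<in> B" "u + w = r + v" unfolding up_iff by blast
    have vs: "v \<in> prods s" using v(1) B(1) by blast
    have L: "?L u y + ?L w y = ?L r y + ?L v y" for y
      using arg_cong[OF v(2), of "\<lambda>p. ?L p y"] by (simp add: lookup_add)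
    have wk: "y \<in> Poly_Mapping.keys w" if "?L u y < ?L v y" for y
      using L[of y] that by (simp add: in_keys_iff)
    obtain z where z: "z \<in> V" "?L u z < ?L v z" "\<And>y. y \<in> V \<Longrightarrow> idx y < idx z \<Longrightarrow> ?L u y = ?L v y"
      using B(2)[OF v(1)] unfolding lex_less_def by blast
    from exchange[OF u vs z(2)]
    consider (swap) z' u' where "?L v z' < ?L u z'" "u' \<in> prods s" "u' + expo z' = u + expo z"
      | (grow) z' where "z' \<in> X \<longleftrightarrow> z \<notin> X" "?L u z' < ?L v z'" "u + expo z + expo z' \<in> prods (Suc s)"
      by blast
    then show ?thesis
    proof cases
      case swap
      have "z' \<in> Poly_Mapping.keys u" using swap(1) by (simp add: in_keys_iff)
      then have "z' \<in> V" using prods_keys_V[OF u] by (rule rev_subsetD)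
      then have "\<not> idx z' < idx z" using z(3)[of z'] swap(1) by auto
      moreover have "z' \<noteq> z" using swap(1) z(2) by auto
      then have "idx z' \<noteq> idx z" using inj_idx \<open>z' \<in> V\<close> z(1) by (meson inj_onD)
      ultimately have "lex_less u u'" using lex_less_exchange[OF swap(3) z(1)] by simp
      then have "u' \<in> B" by (rule above[OF swap(2)])
      then have "z \<in> ?D" using swap(3) z(1) by (intro CollectI conjI bexI[of _ u'] exI[of _ z'])
      then have "w \<in> touching ?D" using wk[OF z(2)] by (rule touchingI)
      then show ?thesis by (rule UnI2)
    next
      case grow
      have "w \<in> ?e"
        using linkedI[OF grow(1,3)]
      proof
        assume "(z, z') \<in> linked s u"
        then show ?thesis using wk[OF z(2)] wk[OF grow(2)] unfolding edge_monoms_def by blast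
      next
        assume "(z', z) \<in> linked s u"
        then show ?thesis using wk[OF z(2)] wk[OF grow(2)] unfolding edge_monoms_def by blast
      qed
      then show ?thesis by (rule UnI1)
    qed
  qed
next
  fix w assume "w \<in> ?e \<union> touching ?D"
  then show "w \<in> ?l"
  proof
    assume "w \<in> ?e"
    then show ?thesis using colon_next_power[OF u, of w] by simp
  next
    assume "w \<in> touching ?D"
    then obtain z where z0: "z \<in> Poly_Mapping.keys w" "z \<in> ?D" unfolding touching_def by auto
    obtain u' z' where z: "z \<in> Poly_Mapping.keys w" "u' \<in> B" "u' + expo z' = u + expo z"
      using z0 by auto
    have "w \<in> multiples (expo z)" using z(1) unfolding expo_def multiples_single touching_def by blast
    then obtain r where "w = r + expo z" unfolding multiples_def by blast
    then have "u + w = r + (u + expo z)" by (simp add: ac_simps)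
    also have "\<dots> = (r + expo z') + u'" unfolding z(3)[symmetric] by (simp add: ac_simps)
    finally have "u + w \<in> up_set B" using z(2) unfolding up_iff by blast
    then show ?thesis by blast
  qed
qed

lemma up_closed_powers: "up_closed (up_set (prods s) \<union> up_set B)"
  by (intro up_closed_Un up_closed_up)

text \<open>The bound \<open>reg R/I\<^sup>s \<le> 2s + m - 2\<close>. It also holds for \<open>s = 0\<close>, where the quotient is zero, and
  this is where the induction starts. The inner induction runs over upper segments \<open>B\<close> in the
  lexicographic order, from all products of \<open>s\<close> edges down to the empty set.\<close>

theorem koszul_vanishes_power:
  assumes HH: "finite HH" "\<And>H. H \<in> HH \<Longrightarrow> chain_graph H" "\<Union>HH = G"
    and d: "int p + 2 * int s + int (card HH) - 2 < d"
  shows "koszul_vanishes (mon_ideal V (up_set (prods s)) :: ('v, 'k::field) mpoly set) p d"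
  using d
proof (induction s arbitrary: d)
  case 0
  have UNIV: "m \<in> up_set (prods 0)" for m unfolding up_iff by simp
  show ?case unfolding koszul_vanishes_def
  proof (intro ballI impI bexI allI)
    fix c :: "'v set \<Rightarrow> ('v, 'k) mpoly" and S
    assume c: "c \<in> koszul_chains p d"
    show "c S - bd (\<lambda>_. 0) S \<in> mon_ideal V (up_set (prods 0))"
      using chains_hom[OF c, of S] UNIV by (auto simp: mon_ideal_def bd_def hom_part_def)
  qed simp
next
  case (Suc s)
  have "koszul_vanishes (mon_ideal V (up_set (prods (Suc s)) \<union> up_set B) :: ('v, 'k) mpoly set) p d"
    if "B \<subseteq> prods s" "\<And>u v. u \<in> B \<Longrightarrow> v \<in> prods s \<Longrightarrow> lex_less u v \<Longrightarrow> v \<in> B" for B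
    using that
  proof (induction "card (prods s - B)" arbitrary: B rule: less_induct)
    case less
    show ?case
    proof (cases "B = prods s")
      case True
      have "up_set (prods (Suc s)) \<subseteq> up_set (prods s)"
      proof
        fix m assume "m \<in> up_set (prods (Suc s))"
        then obtain r a b g where m: "m = r + (expo a + expo b + g)" "g \<in> prods s"
          unfolding up_iff edge_products.simps by blast
        then have "m = (r + expo a + expo b) + g" by (simp add: ac_simps)
        then show "m \<in> up_set (prods s)" using m(2) unfolding up_iff by blast
      qed
      then have "up_set (prods (Suc s)) \<union> up_set B = up_set (prods s)" using True by blast
      then show ?thesis using Suc.IH[of d] Suc.prems by simp
    next
      case False
      have fin: "finite (prods s - B)" using finite_prods[OF finite_G] by blast
      moreover have "prods s - B \<noteq> {}" using False less.prems(1) by blast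
      moreover have "transp_on (prods s - B) lex_less" by (intro transp_onI) (rule lex_less_trans)
      moreover have "asymp_on (prods s - B) lex_less"
        by (intro asymp_onI) (use lex_less_trans lex_less_irrefl in blast)
      ultimately obtain u where u: "u \<in> prods s" "u \<notin> B"
        and max: "\<And>v. v \<in> prods s - B \<Longrightarrow> \<not> lex_less u v"
        using Finite_Set.bex_max_element[of "prods s - B" lex_less] lex_less_irrefl by (metis Diff_iff)
      have above: "v \<in> B" if "v \<in> prods s" "lex_less u v" for v using max that by blast
      have less_u: "lex_less u v" if v: "v \<in> B" for v
      proof -
        have vs: "v \<in> prods s" using v less.prems(1) by blast
        have "\<not> lex_less v u" using less.prems(2)[OF v u(1)] u(2) by blast
        moreover have "u \<noteq> v" using v u(2) by blast
        ultimately show ?thesis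
          using lex_less_total[OF prods_keys_V[OF u(1)] prods_keys_V[OF vs]] by blast
      qed
      define D where "D = {z \<in> V. \<exists>u'\<in>B. \<exists>z'. u' + expo z' = u + expo z}"
      obtain HH' where HH': "finite HH'" "card HH' \<le> card HH" "\<And>H. H \<in> HH' \<Longrightarrow> chain_graph H"
        "\<Union>HH' = linked s u" using linked_chain_cover[OF u(1) HH] by blast
      have colon: "{w. u + w \<in> up_set (prods (Suc s)) \<union> up_set B} = edge_monoms (\<Union>HH') \<union> touching D"
        unfolding HH'(4) D_def
        by (rule colon_lex_segment[OF u(1) less.prems(1)]) (use less_u above in blast)+
      have "\<Union>HH' \<subseteq> X \<times> Y" unfolding HH'(4) linked_def by blast
      then have v1: "koszul_vanishes (mon_ideal V (edge_monoms (\<Union>HH') \<union> touching D) :: ('v, 'k) mpoly set) p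
          (d - int (monom_degree u))"
        using HH'(2) Suc.prems prods_degree[OF u(1)]
        by (intro koszul_vanishes_chain_cover[OF HH'(1,3) _ disj parts]) (auto simp: D_def)
      have plus: "up_set (prods (Suc s)) \<union> up_set B \<union> multiples u = up_set (prods (Suc s)) \<union> up_set (insert u B)"
        by (simp add: up_insert Un_assoc)
      have "prods s - insert u B \<subset> prods s - B" using u by blast
      then have "card (prods s - insert u B) < card (prods s - B)" by (rule psubset_card_mono[OF fin])
      then have v2: "koszul_vanishes (mon_ideal V (up_set (prods (Suc s)) \<union> up_set (insert u B)) :: ('v, 'k) mpoly set) p d"
        by (rule less.hyps) (use u(1) less.prems above in blast)+
      show ?thesis
        by (rule koszul_vanishes_colon[OF up_closed_powers prods_keys_V[OF u(1)]])
          (unfold colon plus, rule v1, rule v2)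
    qed
  qed
  note segment = this
  have "up_set (prods (Suc s)) \<union> up_set {} = up_set (prods (Suc s))" unfolding up_set_def by blast
  with segment[of "{}"] show ?case by (metis empty_iff empty_subsetI)
qed

end

section \<open>Powers of the edge ideal as monomial ideals\<close>

text \<open>Each term of \<open>p\<close> is a multiple of some generator \<open>g m\<close>; the terms have to be collected by generator,
  because an element of the generated ideal is a combination with one coefficient for each generator.\<close>

lemma gen_ideal_eq_mon_ideal:
  fixes B :: "('v, 'k::field) mpoly set"
  assumes sub: "B \<subseteq> mon_ideal V (up_set P)" and sup: "(\<lambda>g. Poly_Mapping.single g 1) ` P \<subseteq> B"
  shows "gen_ideal V B = mon_ideal V (up_set P)"
proof (intro set_eqI iffI)
  fix p assume "p \<in> gen_ideal V B"
  then obtain A q where p: "p = (\<Sum>b\<in>A. q b * b)" "A \<subseteq> B" "\<forall>b\<in>A. q b \<in> poly_ring V"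
    unfolding gen_ideal_def by blast
  show "p \<in> mon_ideal V (up_set P)" unfolding p(1)
    by (intro mon_ideal_sum mon_ideal_mult up_closed_up) (use p sub in auto)
next
  fix p :: "('v, 'k) mpoly" assume p: "p \<in> mon_ideal V (up_set P)"
  let ?K = "Poly_Mapping.keys p"
  have "\<exists>g. g \<in> P \<and> (\<exists>r. m = r + g)" if "m \<in> ?K" for m
  proof -
    have "m \<in> up_set P" using p that unfolding mon_ideal_def by blast
    then show ?thesis unfolding up_iff by blast
  qed
  then obtain g where g: "\<And>m. m \<in> ?K \<Longrightarrow> g m \<in> P \<and> (\<exists>r. m = r + g m)" by metis
  then obtain r where r: "\<And>m. m \<in> ?K \<Longrightarrow> m = r m + g m" by metis
  define b where "b m = (Poly_Mapping.single (g m) 1 :: ('v, 'k) mpoly)" for m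
  define t where "t m = (Poly_Mapping.single (r m) (Poly_Mapping.lookup p m) :: ('v, 'k) mpoly)" for m
  define q where "q x = (\<Sum>m\<in>{m \<in> ?K. b m = x}. t m)" for x
  have tb: "t m * b m = Poly_Mapping.single m (Poly_Mapping.lookup p m)" if "m \<in> ?K" for m
    unfolding t_def b_def mult_single using r[OF that, symmetric] by simp
  have "(\<Sum>m\<in>?K. t m * b m) = (\<Sum>m\<in>?K. Poly_Mapping.single m (Poly_Mapping.lookup p m))"
    by (rule sum.cong[OF refl tb])
  then have "p = (\<Sum>m\<in>?K. t m * b m)" using mpoly_expand[of p] by metis
  also have "\<dots> = (\<Sum>x\<in>b ` ?K. \<Sum>m\<in>{m \<in> ?K. b m = x}. t m * b m)"
    by (rule sum.image_gen) simp
  also have "\<dots> = (\<Sum>x\<in>b ` ?K. q x * x)"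
  proof (rule sum.cong[OF refl])
    fix x
    have "(\<Sum>m\<in>{m \<in> ?K. b m = x}. t m * b m) = (\<Sum>m\<in>{m \<in> ?K. b m = x}. t m * x)"
      by (rule sum.cong) simp_all
    then show "(\<Sum>m\<in>{m \<in> ?K. b m = x}. t m * b m) = q x * x"
      unfolding q_def sum_distrib_right .
  qed
  finally have p_eq: "p = (\<Sum>x\<in>b ` ?K. q x * x)" .
  have "b ` ?K \<subseteq> B" using g sup unfolding b_def by blast
  moreover have "q x \<in> poly_ring V" for x
    unfolding q_def
  proof (rule poly_ring_sum)
    fix m assume "m \<in> {m \<in> ?K. b m = x}"
    then have m: "m \<in> ?K" by simp
    have "Poly_Mapping.keys m \<subseteq> V" using p m by (auto simp: mon_ideal_def poly_ring_def)
    then have "Poly_Mapping.keys (r m) \<subseteq> V"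
      using arg_cong[OF r[OF m], of Poly_Mapping.keys] unfolding keys_add_nat by blast
    then show "t m \<in> poly_ring V" by (simp add: t_def poly_ring_def)
  qed
  ultimately show "p \<in> gen_ideal V B"
    unfolding gen_ideal_def using p_eq by (intro CollectI exI[of _ "b ` ?K"] exI[of _ q]) simp
qed

definition bipartite_edges :: "'v set \<Rightarrow> 'v set \<Rightarrow> 'v set set \<Rightarrow> ('v \<times> 'v) set" where
  "bipartite_edges X Y E = {(x, y). x \<in> X \<and> y \<in> Y \<and> {x, y} \<in> E}"

lemma var_mult_var: "var x * var y = Poly_Mapping.single (expo x + expo y) 1"
  by (simp add: var_def expo_def mult_single)

lemma prods_1: "edge_products G (Suc 0) = {expo a + expo b | a b. (a, b) \<in> G}"
  unfolding edge_products.simps by (simp add: set_eq_iff)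

lemma edge_ideal_eq:
  "(edge_ideal X Y E :: ('v, 'k::field) mpoly set)
    = mon_ideal (X \<union> Y) (up_set (edge_products (bipartite_edges X Y E) (Suc 0)))"
  unfolding edge_ideal_def
proof (rule gen_ideal_eq_mon_ideal)
  let ?P = "edge_products (bipartite_edges X Y E) (Suc 0)"
  have eq: "{var x * var y | x y. x \<in> X \<and> y \<in> Y \<and> {x, y} \<in> E}
      = (\<lambda>g. Poly_Mapping.single g 1 :: ('v, 'k) mpoly) ` ?P"
    unfolding prods_1 bipartite_edges_def var_mult_var by blast
  have "Poly_Mapping.single g 1 \<in> mon_ideal (X \<union> Y) (up_set ?P)" if g: "g \<in> ?P" for g
  proof -
    have "g \<in> up_set ?P" unfolding up_iff using g by (intro bexI[of _ g] exI[of _ 0]) auto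
    moreover have "Poly_Mapping.keys g \<subseteq> X \<union> Y"
      using g unfolding prods_1 bipartite_edges_def by (auto simp: keys_add_nat)
    ultimately show ?thesis by (simp add: mon_ideal_def poly_ring_def)
  qed
  then show "{var x * var y | x y. x \<in> X \<and> y \<in> Y \<and> {x, y} \<in> E} \<subseteq> (mon_ideal (X \<union> Y) (up_set ?P) :: ('v, 'k) mpoly set)"
    unfolding eq by blast
  show "(\<lambda>g. Poly_Mapping.single g 1 :: ('v, 'k) mpoly) ` ?P \<subseteq> {var x * var y | x y. x \<in> X \<and> y \<in> Y \<and> {x, y} \<in> E}"
    unfolding eq ..
qed

lemma prod_in_power:
  assumes "\<And>i. i < s \<Longrightarrow> (f i :: ('v, 'k::field) mpoly) \<in> mon_ideal V (up_set (edge_products G (Suc 0)))"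
  shows "(\<Prod>i<s. f i) \<in> mon_ideal V (up_set (edge_products G s))"
  using assms
proof (induction s)
  case 0
  have "0 \<in> up_set (edge_products G 0)" unfolding up_iff by simp
  then show ?case by (simp add: mon_ideal_def)
next
  case (Suc s)
  have 1: "(\<Prod>i<s. f i) \<in> mon_ideal V (up_set (edge_products G s))" using Suc by simp
  have 2: "f s \<in> mon_ideal V (up_set (edge_products G (Suc 0)))" using Suc.prems by simp
  have "m \<in> up_set (edge_products G (Suc s))" if m: "m \<in> Poly_Mapping.keys ((\<Prod>i<s. f i) * f s)" for m
    using m
  proof (rule keys_multE)
    fix x y assume m: "m = x + y" and "x \<in> Poly_Mapping.keys (\<Prod>i<s. f i)" "y \<in> Poly_Mapping.keys (f s)"
    then have "x \<in> up_set (edge_products G s)" "y \<in> up_set (edge_products G (Suc 0))"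
      using 1 2 unfolding mon_ideal_def by blast+
    then obtain r g r' a b where *: "x = r + g" "g \<in> edge_products G s" "y = r' + (expo a + expo b)" "(a, b) \<in> G"
      unfolding up_iff prods_1 by blast
    then have "m = (r + r') + (expo a + expo b + g)" using m by (simp add: ac_simps)
    moreover have "expo a + expo b + g \<in> edge_products G (Suc s)"
      unfolding edge_products.simps using *(2,4) by blast
    ultimately show ?thesis unfolding up_iff by blast
  qed
  moreover have "(\<Prod>i<s. f i) * f s \<in> poly_ring V"
    using 1 2 by (simp add: mon_ideal_def poly_ring_mult)
  ultimately show ?case by (auto simp: mon_ideal_def)
qed

lemma edge_product_is_prod:
  assumes "g \<in> edge_products G s"
  shows "\<exists>f. (\<forall>i<s. \<exists>h\<in>edge_products G (Suc 0). f i = Poly_Mapping.single h 1) \<and>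
    (Poly_Mapping.single g 1 :: ('v, 'k::field) mpoly) = (\<Prod>i<s. f i)"
  using assms
proof (induction s arbitrary: g)
  case (Suc s)
  then obtain a b g0 where g: "g = expo a + expo b + g0" "(a, b) \<in> G" "g0 \<in> edge_products G s"
    unfolding edge_products.simps by blast
  obtain f where f: "\<forall>i<s. \<exists>h\<in>edge_products G (Suc 0). f i = Poly_Mapping.single h 1"
    "(Poly_Mapping.single g0 1 :: ('v, 'k) mpoly) = (\<Prod>i<s. f i)"
    using Suc.IH[OF g(3)] by blast
  let ?h = "expo a + expo b"
  let ?f = "f(s := Poly_Mapping.single ?h 1)"
  have h: "?h \<in> edge_products G (Suc 0)" unfolding prods_1 using g(2) by blast
  have "\<forall>i<Suc s. \<exists>h\<in>edge_products G (Suc 0). ?f i = Poly_Mapping.single h 1"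
    using f(1) h by (auto simp: less_Suc_eq)
  moreover have "(Poly_Mapping.single g 1 :: ('v, 'k) mpoly) = (\<Prod>i<Suc s. ?f i)"
  proof -
    have "(\<Prod>i<s. ?f i) = (\<Prod>i<s. f i)" by (rule prod.cong) auto
    then have "(\<Prod>i<Suc s. ?f i) = Poly_Mapping.single g0 1 * Poly_Mapping.single ?h 1"
      using f(2) by simp
    also have "\<dots> = Poly_Mapping.single g 1" by (simp add: mult_single g(1) add.commute)
    finally show ?thesis by simp
  qed
  ultimately show ?case by blast
qed simp

theorem ideal_power_edge_ideal_eq:
  "(ideal_power (X \<union> Y) (edge_ideal X Y E) s :: ('v, 'k::field) mpoly set)
    = mon_ideal (X \<union> Y) (up_set (edge_products (bipartite_edges X Y E) s))"
  unfolding ideal_power_def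
proof (rule gen_ideal_eq_mon_ideal)
  let ?V = "X \<union> Y" and ?P = "edge_products (bipartite_edges X Y E)"
  show "{(\<Prod>i<s. f i) | f. \<forall>i<s. f i \<in> (edge_ideal X Y E :: ('v, 'k) mpoly set)} \<subseteq> mon_ideal ?V (up_set (?P s))"
    unfolding edge_ideal_eq using prod_in_power by blast
  show "(\<lambda>g. Poly_Mapping.single g 1) ` ?P s
      \<subseteq> {(\<Prod>i<s. f i) | f. \<forall>i<s. f i \<in> (edge_ideal X Y E :: ('v, 'k) mpoly set)}"
  proof (rule image_subsetI)
    fix g assume "g \<in> ?P s"
    then obtain f where f: "\<And>i. i < s \<Longrightarrow> \<exists>h\<in>?P (Suc 0). f i = Poly_Mapping.single h 1"
      "(Poly_Mapping.single g 1 :: ('v, 'k) mpoly) = (\<Prod>i<s. f i)"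
      using edge_product_is_prod by metis
    have "f i \<in> (edge_ideal X Y E :: ('v, 'k) mpoly set)" if i: "i < s" for i
    proof -
      obtain h where h: "h \<in> ?P (Suc 0)" "f i = Poly_Mapping.single h 1" using f(1)[OF i] by blast
      have "h \<in> up_set (?P (Suc 0))" unfolding up_iff using h(1) by (intro bexI[of _ h] exI[of _ 0]) auto
      moreover have "Poly_Mapping.keys h \<subseteq> ?V"
        using h(1) unfolding prods_1 bipartite_edges_def by (auto simp: keys_add_nat)
      ultimately show ?thesis unfolding edge_ideal_eq h(2) by (simp add: mon_ideal_def poly_ring_def)
    qed
    then show "Poly_Mapping.single g 1 \<in> {(\<Prod>i<s. f i) | f. \<forall>i<s. f i \<in> (edge_ideal X Y E :: ('v, 'k) mpoly set)}"
      using f(2) by blast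
  qed
qed

section \<open>From Koszul homology to minimal resolutions\<close>

lemma free_module_0 [simp]: "(\<lambda>_. 0) \<in> free_module V r"
  by (simp add: free_module_def)

lemma free_module_diff:
  "f \<in> free_module V r \<Longrightarrow> h \<in> free_module V r \<Longrightarrow> (\<lambda>j. f j - h j) \<in> free_module V r"
  by (auto simp: free_module_def)

text \<open>The polynomials with constant term zero form an ideal.\<close>

lemma const_mult_eq_0:
  fixes p q :: "('v, 'k::field) mpoly"
  assumes "Poly_Mapping.lookup p 0 = 0"
  shows "Poly_Mapping.lookup (p * q) 0 = 0"
proof (rule ccontr)
  assume "Poly_Mapping.lookup (p * q) 0 \<noteq> 0"
  then have "0 \<in> Poly_Mapping.keys (p * q)" by (simp add: in_keys_iff)
  then obtain a b where ab: "0 = a + b" "a \<in> Poly_Mapping.keys p" by (rule keys_multE)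
  have "monom_degree a + monom_degree b = 0" using ab(1) monom_degree_add[of a b] by simp
  then have "a = 0" by simp
  then show False using ab(2) assms by (simp add: in_keys_iff)
qed

context indexed_variables
begin

text \<open>Koszul chains with coefficients in the graded free module of rank \<open>r\<close> whose \<open>k\<close>-th basis element has
  degree \<open>\<delta> k\<close>, and their differential.\<close>

definition vchains :: "nat \<Rightarrow> (nat \<Rightarrow> int) \<Rightarrow> nat \<Rightarrow> int \<Rightarrow> ('v set \<Rightarrow> nat \<Rightarrow> ('v, 'k::field) mpoly) set" where
  "vchains r \<delta> p d = {c. (\<forall>k<r. (\<lambda>S. c S k) \<in> koszul_chains p (d - \<delta> k)) \<and> (\<forall>S. \<forall>k\<ge>r. c S k = 0)}"

definition vbd :: "('v set \<Rightarrow> nat \<Rightarrow> ('v, 'k::field) mpoly) \<Rightarrow> 'v set \<Rightarrow> nat \<Rightarrow> ('v, 'k) mpoly" where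
  "vbd c S k = bd (\<lambda>S'. c S' k) S"

text \<open>Vanishing of the Koszul homology, in degree \<open>d\<close>, of the quotient of a graded free module by the
  submodule \<open>Z\<close>. The bounding chain \<open>b\<close> may have coefficients of all degrees; that it lives on
  subsets of \<open>V\<close> makes \<open>\<partial>\<partial>b\<close> vanish.\<close>

definition quotient_vanishes ::
    "nat \<Rightarrow> (nat \<Rightarrow> int) \<Rightarrow> (nat \<Rightarrow> ('v, 'k::field) mpoly) set \<Rightarrow> nat \<Rightarrow> int \<Rightarrow> bool" where
  "quotient_vanishes r \<delta> Z p d \<longleftrightarrow>
     (\<forall>c\<in>vchains r \<delta> p d. (\<forall>S. vbd c S \<in> Z) \<longrightarrow>
        (\<exists>b. (\<forall>S. \<not> S \<subseteq> V \<longrightarrow> b S = (\<lambda>_. 0)) \<and> (\<forall>S. (\<lambda>k. c S k - vbd b S k) \<in> Z)))"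

lemma bd_poly_ring:
  assumes "\<And>S. w S \<in> poly_ring V" shows "bd w S \<in> poly_ring V"
  unfolding bd_def
  by (intro poly_ring_sum poly_ring_mult sg_poly_ring var_in_poly_ring assms) auto

lemma bd_off_V:
  assumes "\<And>S. \<not> S \<subseteq> V \<Longrightarrow> w S = 0" "\<not> T \<subseteq> V" shows "bd w T = 0"
proof -
  have "w (insert k T) = 0" for k by (rule assms(1)) (use assms(2) in blast)
  then show ?thesis by (simp add: bd_def)
qed

lemma vbd_free_module:
  assumes "\<And>S. w S \<in> free_module V r" shows "vbd w S \<in> free_module V r"
proof -
  have "w S k \<in> poly_ring V" "r \<le> k \<Longrightarrow> w S k = 0" for S k
    using assms[of S] unfolding free_module_def by (cases "k < r"; simp)+
  then show ?thesis unfolding free_module_def vbd_def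
    by (simp add: bd_poly_ring) (simp add: bd_def)
qed

lemma vchains_free_module:
  assumes "c \<in> vchains r \<delta> p d" shows "c S \<in> free_module V r"
  using assms chains_hom unfolding vchains_def free_module_def hom_part_def by fastforce

lemma vbd_mat_apply: "vbd (\<lambda>S. mat_apply r \<rho> M (c S)) T = mat_apply r \<rho> M (vbd c T)"
proof
  fix k
  show "vbd (\<lambda>S. mat_apply r \<rho> M (c S)) T k = mat_apply r \<rho> M (vbd c T) k"
  proof (cases "k < r")
    case True
    then have "vbd (\<lambda>S. mat_apply r \<rho> M (c S)) T k = bd (\<lambda>S. \<Sum>j<\<rho>. M k j * c S j) T"
      by (simp add: vbd_def mat_apply_def)
    also have "\<dots> = (\<Sum>j<\<rho>. M k j * bd (\<lambda>S. c S j) T)" by (simp add: bd_sum bd_mult)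
    finally show ?thesis using True by (simp add: mat_apply_def vbd_def)
  next
    case False
    then show ?thesis by (simp add: mat_apply_def vbd_def bd_def)
  qed
qed

lemma mat_apply_diff: "mat_apply r \<rho> M (\<lambda>j. f j - h j) = (\<lambda>k. mat_apply r \<rho> M f k - mat_apply r \<rho> M h k)"
  by (auto simp: mat_apply_def algebra_simps sum_subtractf)

text \<open>Dimension shifting. Let \<open>\<phi>\<close> be the map of free modules with matrix \<open>M\<close>. The quotient of its source by
  its kernel is its image, and the image is also the submodule by which the target is divided. A
  cycle \<open>c\<close> modulo the kernel has \<open>\<partial>\<phi>(c) = 0\<close>, so exactness of the Koszul complex gives \<open>\<phi>(c) = \<partial>a\<close>. By
  assumption \<open>a\<close> agrees up to a boundary with some \<open>\<phi>(h)\<close>, and \<open>c - \<partial>h\<close> lies in the kernel. In homological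
  degree 0 exactness needs \<open>\<phi>(c)\<close> to have constant terms zero, which follows from a positive degree or from
  minimality.\<close>

theorem quotient_vanishes_syzygy:
  fixes M :: "nat \<Rightarrow> nat \<Rightarrow> ('v, 'k::field) mpoly"
  assumes hom: "\<And>k j. k < r \<Longrightarrow> j < \<rho> \<Longrightarrow> M k j \<in> hom_part V (\<epsilon> j - \<delta> k)"
    and const: "\<And>k. p = 0 \<Longrightarrow> k < r \<Longrightarrow> \<delta> k < d \<or> (\<forall>j<\<rho>. Poly_Mapping.lookup (M k j) 0 = 0)"
    and van: "quotient_vanishes r \<delta> (mat_apply r \<rho> M ` free_module V \<rho>) (Suc p) d"
  shows "quotient_vanishes \<rho> \<epsilon> {f \<in> free_module V \<rho>. mat_apply r \<rho> M f = (\<lambda>_. 0)} p d"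
  unfolding quotient_vanishes_def
proof (intro ballI impI)
  fix c :: "'v set \<Rightarrow> nat \<Rightarrow> ('v, 'k) mpoly"
  let ?\<phi> = "mat_apply r \<rho> M"
  assume c: "c \<in> vchains \<rho> \<epsilon> p d"
    and cycle: "\<forall>S. vbd c S \<in> {f \<in> free_module V \<rho>. ?\<phi> f = (\<lambda>_. 0)}"
  have cfree: "c S \<in> free_module V \<rho>" for S by (rule vchains_free_module[OF c])
  have "\<exists>a. a \<in> koszul_chains (Suc p) (d - \<delta> k) \<and> (\<forall>S. bd a S = ?\<phi> (c S) k)" if k: "k < r" for k
  proof -
    let ?c = "\<lambda>S. ?\<phi> (c S) k"
    have eq: "?c S = (\<Sum>j<\<rho>. M k j * c S j)" for S using k by (simp add: mat_apply_def)
    have cj: "(\<lambda>S. c S j) \<in> koszul_chains p (d - \<epsilon> j)" if "j < \<rho>" for j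
      using c that unfolding vchains_def by blast
    have chain: "?c \<in> koszul_chains p (d - \<delta> k)"
    proof (rule chainsI)
      fix S
      show "?c S \<in> hom_part V (d - \<delta> k - int p)" unfolding eq
      proof (rule hom_part_sum)
        fix j assume "j \<in> {..<\<rho>}"
        then have j: "j < \<rho>" by simp
        have "M k j * c S j \<in> hom_part V ((\<epsilon> j - \<delta> k) + (d - \<epsilon> j - int p))"
          by (intro hom_part_mult hom k j chains_hom[OF cj[OF j], of S])
        then show "M k j * c S j \<in> hom_part V (d - \<delta> k - int p)" by (simp add: algebra_simps)
      qed
    next
      fix S assume S: "\<not> (S \<subseteq> V \<and> card S = p)"
      have "c S j = 0" if "j < \<rho>" for j using chains_zero[OF cj[OF that] S] .
      then show "?c S = 0" unfolding eq by simp
    qed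
    have bd0: "bd ?c S = 0" for S
    proof -
      have "bd ?c S = vbd (\<lambda>S. ?\<phi> (c S)) S k" by (simp add: vbd_def)
      also have "\<dots> = ?\<phi> (vbd c S) k" by (simp only: vbd_mat_apply)
      also have "\<dots> = 0" using cycle by simp
      finally show ?thesis .
    qed
    have const0: "Poly_Mapping.lookup (?c {}) 0 = 0" if p: "p = 0"
      using const[OF p k]
    proof
      assume "\<delta> k < d"
      then have "0 \<notin> Poly_Mapping.keys (?c {})"
        using hom_part_mon_degree[OF chains_hom[OF chain, of "{}"], of 0] p by force
      then show ?thesis by (simp add: in_keys_iff)
    next
      assume "\<forall>j<\<rho>. Poly_Mapping.lookup (M k j) 0 = 0"
      then show ?thesis unfolding eq lookup_sum by (intro sum.neutral ballI const_mult_eq_0) simp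
    qed
    obtain a where "a \<in> koszul_chains (Suc p) (d - \<delta> k)" "\<And>S. bd a S = ?c S"
      by (rule koszul_exact[OF chain bd0 const0]) blast+
    then show ?thesis by blast
  qed
  then obtain a0 where a0: "\<And>k. k < r \<Longrightarrow> a0 k \<in> koszul_chains (Suc p) (d - \<delta> k)"
    "\<And>k S. k < r \<Longrightarrow> bd (a0 k) S = ?\<phi> (c S) k" by metis
  define a where "a S k = (if k < r then a0 k S else 0)" for S k
  have a: "a \<in> vchains r \<delta> (Suc p) d"
    unfolding vchains_def a_def using a0(1) by simp
  have bda: "vbd a S = ?\<phi> (c S)" for S
  proof
    fix k show "vbd a S k = ?\<phi> (c S) k"
      using a0(2)[of k S] by (cases "k < r") (simp_all add: vbd_def a_def mat_apply_def bd_def)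
  qed
  have "\<forall>S. vbd a S \<in> ?\<phi> ` free_module V \<rho>" unfolding bda using cfree by blast
  then obtain b where b: "\<And>S. \<not> S \<subseteq> V \<Longrightarrow> b S = (\<lambda>_. 0)"
    "\<And>S. (\<lambda>k. a S k - vbd b S k) \<in> ?\<phi> ` free_module V \<rho>"
    using van a unfolding quotient_vanishes_def by blast
  obtain h0 where h0: "\<And>S. h0 S \<in> free_module V \<rho>" "\<And>S. (\<lambda>k. a S k - vbd b S k) = ?\<phi> (h0 S)"
    using b(2) unfolding image_iff by metis
  define h where "h S = (if S \<subseteq> V then h0 S else (\<lambda>_. 0))" for S
  have hfree: "h S \<in> free_module V \<rho>" for S unfolding h_def using h0(1) by simp
  have h: "a S k - vbd b S k = ?\<phi> (h S) k" for S k
  proof (cases "S \<subseteq> V")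
    case True
    then show ?thesis using fun_cong[OF h0(2)[of S], of k] by (simp add: h_def)
  next
    case False
    have "a S k = 0" using chains_zero[OF a0(1)] False by (simp add: a_def)
    moreover have "vbd b S k = 0" unfolding vbd_def by (rule bd_off_V[OF _ False]) (simp add: b(1))
    ultimately show ?thesis using False by (simp add: h_def mat_apply_def)
  qed
  have "?\<phi> (vbd h S) k = ?\<phi> (c S) k" for S k
  proof -
    have "?\<phi> (vbd h S) k = vbd (\<lambda>S. ?\<phi> (h S)) S k" by (simp only: vbd_mat_apply)
    also have "\<dots> = bd (\<lambda>S. a S k - vbd b S k) S" by (simp add: vbd_def h[symmetric])
    also have "\<dots> = vbd a S k - bd (bd (\<lambda>S. b S k)) S" by (simp add: vbd_def bd_diff)
    also have "bd (bd (\<lambda>S. b S k)) S = 0" by (rule bd_bd) (simp add: b(1))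
    finally show ?thesis by (simp add: bda)
  qed
  then have "?\<phi> (\<lambda>j. c S j - vbd h S j) = (\<lambda>_. 0)" for S by (simp add: mat_apply_diff)
  moreover have "(\<lambda>j. c S j - vbd h S j) \<in> free_module V \<rho>" for S
    by (rule free_module_diff[OF cfree vbd_free_module[OF hfree]])
  ultimately show "\<exists>b. (\<forall>S. \<not> S \<subseteq> V \<longrightarrow> b S = (\<lambda>_. 0)) \<and>
      (\<forall>S. (\<lambda>k. c S k - vbd b S k) \<in> {f \<in> free_module V \<rho>. ?\<phi> f = (\<lambda>_. 0)})"
    by (intro exI[of _ h]) (simp add: h_def)
qed

lemma quotient_vanishes_ideal:
  fixes I :: "('v, 'k::field) mpoly set"
  assumes "koszul_vanishes I p d"
  shows "quotient_vanishes (Suc 0) (\<lambda>_. 0) {f. f 0 \<in> I \<and> (\<forall>k\<ge>Suc 0. f k = 0)} p d"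
  unfolding quotient_vanishes_def
proof (intro ballI impI)
  fix c :: "'v set \<Rightarrow> nat \<Rightarrow> ('v, 'k) mpoly"
  assume c: "c \<in> vchains (Suc 0) (\<lambda>_. 0) p d"
    and cycle: "\<forall>S. vbd c S \<in> {f. f 0 \<in> I \<and> (\<forall>k\<ge>Suc 0. f k = 0)}"
  have c0: "(\<lambda>S. c S 0) \<in> koszul_chains p d" and ck: "\<And>S k. Suc 0 \<le> k \<Longrightarrow> c S k = 0"
    using c unfolding vchains_def by simp_all
  obtain b where b: "b \<in> koszul_chains (Suc p) d" "\<And>S. c S 0 - bd b S \<in> I"
    by (rule koszul_vanishesE[OF assms c0]) (use cycle in \<open>auto simp: vbd_def\<close>)
  define b' where "b' S k = (if k = 0 then b S else 0)" for S and k :: nat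
  have "vbd b' S k = (if k = 0 then bd b S else 0)" for S k
    by (simp add: vbd_def b'_def bd_def)
  then have "(\<lambda>k. c S k - vbd b' S k) \<in> {f. f 0 \<in> I \<and> (\<forall>k\<ge>Suc 0. f k = 0)}" for S
    using b(2) ck by simp
  moreover have "b' S = (\<lambda>_. 0)" if "\<not> S \<subseteq> V" for S
    using chains_zero[OF b(1), of S] that by (auto simp: b'_def)
  ultimately show "\<exists>b. (\<forall>S. \<not> S \<subseteq> V \<longrightarrow> b S = (\<lambda>_. 0)) \<and>
      (\<forall>S. (\<lambda>k. c S k - vbd b S k) \<in> {f. f 0 \<in> I \<and> (\<forall>k\<ge>Suc 0. f k = 0)})"
    by (intro exI[of _ b']) blast
qed

text \<open>If the \<open>i\<close>-th free module of a minimal resolution has a basis element \<open>e\<close> of positive degree \<open>d\<close>,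
  then \<open>H\<^sub>i\<^sub>+\<^sub>1(R/I)\<^sub>d \<noteq> 0\<close>. Otherwise dimension shifting down the resolution would write \<open>e\<close> as a
  boundary plus an element of the image of the next matrix. Boundaries have coefficients in the
  maximal ideal, and so does that image by minimality, but \<open>e\<close> has the coefficient 1.\<close>

theorem no_generator_where_koszul_vanishes:
  fixes I :: "('v, 'k::field) mpoly set"
  assumes res: "minimal_graded_free_resolution V I r dg g A" and j: "j < r i"
    and van: "koszul_vanishes I (Suc i) (dg i j)"
  shows "dg i j \<le> 0"
proof (rule ccontr)
  assume "\<not> dg i j \<le> 0"
  define d where "d = dg i j"
  have d: "0 < d" using \<open>\<not> dg i j \<le> 0\<close> by (simp add: d_def)
  note defs = minimal_graded_free_resolution_def graded_free_resolution_def
  have g': "\<forall>j<r 0. g j \<in> poly_ring V \<and> homogeneous (dg 0 j) (g j)"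
    and A': "\<forall>i. \<forall>k<r i. \<forall>j<r (Suc i).
      A i k j \<in> poly_ring V \<and> homogeneous (dg (Suc i) j - dg i k) (A i k j)"
    and A0': "\<forall>i. \<forall>k<r i. \<forall>j<r (Suc i). Poly_Mapping.lookup (A i k j) 0 = 0"
    and ex_I: "(\<lambda>f. \<Sum>j<r 0. f j * g j) ` free_module V (r 0) = I"
    and ex_0: "{f \<in> free_module V (r 0). (\<Sum>j<r 0. f j * g j) = 0} =
       mat_apply (r 0) (r 1) (A 0) ` free_module V (r 1)"
    and ex: "\<forall>i. {f \<in> free_module V (r (Suc i)). mat_apply (r i) (r (Suc i)) (A i) f = (\<lambda>_. 0)} =
        mat_apply (r (Suc i)) (r (Suc (Suc i))) (A (Suc i)) ` free_module V (r (Suc (Suc i)))"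
    by (insert res[unfolded defs], elim conjE, assumption)+
  have g: "g j \<in> hom_part V (dg 0 j)" if "j < r 0" for j
    using g' that unfolding hom_part_def by simp
  have A: "A i k j \<in> hom_part V (dg (Suc i) j - dg i k)" if "k < r i" "j < r (Suc i)" for i k j
    using A' that unfolding hom_part_def by simp
  have A0: "Poly_Mapping.lookup (A i k j) 0 = 0" if "k < r i" "j < r (Suc i)" for i k j
    using A0' that by simp
  let ?g = "\<lambda>k j. g j"
  have mat_g: "mat_apply (Suc 0) (r 0) ?g f = (\<lambda>k. if k = 0 then \<Sum>j<r 0. f j * g j else 0)" for f
    by (auto simp: mat_apply_def mult.commute)
  define Z where "Z i = mat_apply (r i) (r (Suc i)) (A i) ` free_module V (r (Suc i))" for i
  have im_g: "{f. f 0 \<in> I \<and> (\<forall>k\<ge>Suc 0. f k = 0)} = mat_apply (Suc 0) (r 0) ?g ` free_module V (r 0)"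
  proof (intro set_eqI iffI)
    fix f :: "nat \<Rightarrow> ('v, 'k) mpoly"
    assume f: "f \<in> {f. f 0 \<in> I \<and> (\<forall>k\<ge>Suc 0. f k = 0)}"
    then obtain h where h: "h \<in> free_module V (r 0)" "f 0 = (\<Sum>j<r 0. h j * g j)" using ex_I by blast
    have "f = mat_apply (Suc 0) (r 0) ?g h"
      unfolding mat_g using f h(2) by (intro ext) (auto simp: Suc_le_eq)
    then show "f \<in> mat_apply (Suc 0) (r 0) ?g ` free_module V (r 0)" using h(1) by blast
  next
    fix f :: "nat \<Rightarrow> ('v, 'k) mpoly"
    assume "f \<in> mat_apply (Suc 0) (r 0) ?g ` free_module V (r 0)"
    then show "f \<in> {f. f 0 \<in> I \<and> (\<forall>k\<ge>Suc 0. f k = 0)}" using ex_I unfolding mat_g by auto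
  qed
  have Z0: "Z 0 = {f \<in> free_module V (r 0). mat_apply (Suc 0) (r 0) ?g f = (\<lambda>_. 0)}"
  proof -
    have "mat_apply (Suc 0) (r 0) ?g f = (\<lambda>_. 0) \<longleftrightarrow> (\<Sum>j<r 0. f j * g j) = 0" for f
      unfolding mat_g by (auto simp: fun_eq_iff)
    then show ?thesis unfolding Z_def using ex_0 by simp
  qed
  have ZS: "Z (Suc n) = {f \<in> free_module V (r (Suc n)). mat_apply (r n) (r (Suc n)) (A n) f = (\<lambda>_. 0)}" for n
    unfolding Z_def using ex by simp
  \<comment> \<open>The submodule \<open>Z n\<close> is the kernel of the map out of the \<open>n\<close>-th free module, so the augmentation accounts for the first of the \<open>n + 1\<close> shifts.\<close>
  have shift: "quotient_vanishes (r n) (dg n) (Z n) p d" if "koszul_vanishes I (Suc (n + p)) d" for n p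
    using that
  proof (induction n arbitrary: p)
    case 0
    show ?case unfolding Z0
    proof (rule quotient_vanishes_syzygy[where \<delta> = "\<lambda>_. 0"])
      show "quotient_vanishes (Suc 0) (\<lambda>_. 0) (mat_apply (Suc 0) (r 0) ?g ` free_module V (r 0)) (Suc p) d"
        unfolding im_g[symmetric] by (rule quotient_vanishes_ideal) (use 0 in simp)
    next
      show "g j \<in> hom_part V (dg 0 j - 0)" if "j < r 0" for j using g[OF that] by simp
      show "0 < d \<or> (\<forall>j<r 0. Poly_Mapping.lookup (g j) 0 = 0)" using d by blast
    qed
  next
    case (Suc n)
    have IH: "quotient_vanishes (r n) (dg n) (Z n) (Suc p) d" by (rule Suc.IH) (use Suc.prems in simp)
    show ?case unfolding ZS
    proof (rule quotient_vanishes_syzygy[where \<delta> = "dg n"])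
      show "quotient_vanishes (r n) (dg n) (mat_apply (r n) (r (Suc n)) (A n) ` free_module V (r (Suc n))) (Suc p) d"
        using IH unfolding Z_def .
    next
      show "A n k j \<in> hom_part V (dg (Suc n) j - dg n k)" if "k < r n" "j < r (Suc n)" for k j
        using A[OF that] .
      show "dg n k < d \<or> (\<forall>j<r (Suc n). Poly_Mapping.lookup (A n k j) 0 = 0)" if "k < r n" for k
        using A0[OF that] by blast
    qed
  qed
  have Q: "quotient_vanishes (r i) (dg i) (Z i) 0 d"
    by (rule shift) (use van in \<open>simp add: d_def\<close>)
  define c :: "'v set \<Rightarrow> nat \<Rightarrow> ('v, 'k) mpoly"
    where "c S k = (if S = {} \<and> k = j then 1 else 0)" for S k
  have c: "c \<in> vchains (r i) (dg i) 0 d"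
  proof -
    have "(\<lambda>S. c S k) \<in> koszul_chains 0 (d - dg i k)" for k
    proof (rule chainsI)
      show "c S k \<in> hom_part V (d - dg i k - int 0)" for S
        by (auto simp: c_def d_def hom_part_def homogeneous_def)
    next
      fix S assume "\<not> (S \<subseteq> V \<and> card S = 0)"
      then show "c S k = 0" by (auto simp: c_def)
    qed
    moreover have "c S k = 0" if "r i \<le> k" for S k using that j by (simp add: c_def)
    ultimately show ?thesis unfolding vchains_def by blast
  qed
  have vbd0: "vbd c S = (\<lambda>_. 0)" for S
    by (rule ext) (simp add: vbd_def bd_def c_def)
  have "(\<lambda>_. 0) = mat_apply (r i) (r (Suc i)) (A i) (\<lambda>_. 0)"
    by (simp add: mat_apply_def fun_eq_iff)
  then have "(\<lambda>_. 0) \<in> Z i" unfolding Z_def using free_module_0 by (rule image_eqI)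
  then have "\<forall>S. vbd c S \<in> Z i" unfolding vbd0 by blast
  then obtain b where "\<And>S. (\<lambda>k. c S k - vbd b S k) \<in> Z i"
    using Q c unfolding quotient_vanishes_def by blast
  then obtain f where f: "(\<lambda>k. c {} k - vbd b {} k) = mat_apply (r i) (r (Suc i)) (A i) f"
    unfolding Z_def by blast
  have "1 - vbd b {} j = (\<Sum>l<r (Suc i). A i j l * f l)"
    using fun_cong[OF f, of j] j by (simp add: c_def mat_apply_def)
  then have "Poly_Mapping.lookup (1 - vbd b {} j) 0 = (\<Sum>l<r (Suc i). Poly_Mapping.lookup (A i j l * f l) 0)"
    by (simp add: lookup_sum)
  also have "\<dots> = 0" by (intro sum.neutral ballI const_mult_eq_0 A0) (use j in simp_all)
  finally have "Poly_Mapping.lookup (vbd b {} j) 0 = 1" by (simp add: lookup_minus)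
  moreover have "Poly_Mapping.lookup (vbd b {} j) 0 = 0"
  proof -
    have "Poly_Mapping.lookup (var k * (koszul_sign k {} * b {k} j)) 0 = 0" for k
    proof (rule const_mult_eq_0)
      have "Poly_Mapping.single k (1::nat) \<noteq> 0" by (metis lookup_single_eq lookup_zero zero_neq_one)
      then show "Poly_Mapping.lookup (var k) 0 = 0" unfolding var_def by (rule lookup_single_not_eq)
    qed
    then show ?thesis unfolding vbd_def bd_def lookup_sum
      by (intro sum.neutral ballI) (simp add: ac_simps)
  qed
  ultimately show False by simp
qed

corollary regularity_le:
  fixes I :: "('v, 'k::field) mpoly set"
  assumes "0 \<le> B" "\<And>i d. int i + B < d \<Longrightarrow> koszul_vanishes I (Suc i) d"
  shows "regularity V I \<le> ereal (real_of_int B)"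
  unfolding regularity_def
proof (rule Sup_least)
  fix x assume "x \<in> {ereal (real_of_int (dg i j) - real i) | r dg g A i j.
            minimal_graded_free_resolution V I r dg g A \<and> j < r i}"
  then obtain r dg g A i j where x: "x = ereal (real_of_int (dg i j) - real i)"
    and res: "minimal_graded_free_resolution V I r dg g A" "j < r i" by blast
  have "dg i j \<le> int i + B"
  proof (rule ccontr)
    assume "\<not> dg i j \<le> int i + B"
    then have "koszul_vanishes I (Suc i) (dg i j)" "0 < dg i j" using assms by simp_all
    then show False using no_generator_where_koszul_vanishes[OF res] by simp
  qed
  then have "real_of_int (dg i j) - real i \<le> real_of_int B" by linarith
  then show "x \<le> ereal (real_of_int B)" unfolding x by simp
qed

end

section \<open>Vertex covers\<close>

definition star :: "('v \<times> 'v) set \<Rightarrow> 'v \<Rightarrow> ('v \<times> 'v) set" where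
  "star G v = {(a, b) \<in> G. a = v \<or> b = v}"

lemma chain_graph_star:
  assumes "G \<subseteq> X \<times> Y" "X \<inter> Y = {}"
  shows "chain_graph (star G v)"
  using assms unfolding chain_graph_def star_def by blast

text \<open>The stars at the vertices of the cover are the chain graphs.\<close>

theorem regularity_le_vertex_cover:
  assumes XY: "finite X" "finite Y" "X \<inter> Y = {}" and s: "s \<ge> 1"
    and C: "finite C" "\<And>a b. (a, b) \<in> bipartite_edges X Y E \<Longrightarrow> a \<in> C \<or> b \<in> C"
  shows "regularity (X \<union> Y) (ideal_power (X \<union> Y) (edge_ideal X Y E :: ('v, 'k::field) mpoly set) s)
    \<le> ereal (2 * real s + (real (card C) - 1))"
proof -
  let ?G = "bipartite_edges X Y E"
  have G: "?G \<subseteq> X \<times> Y" unfolding bipartite_edges_def by blast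
  obtain idx :: "'v \<Rightarrow> nat" where idx: "inj_on idx (X \<union> Y)"
    using finite_imp_inj_to_nat_seg[of "X \<union> Y"] XY by blast
  interpret bipartite_variables "X \<union> Y" idx X Y ?G
    by unfold_locales (use XY idx G in auto)
  define B where "B = 2 * int s + int (card C) - 1"
  have cover: "\<Union>(star ?G ` C) = ?G"
  proof (intro equalityI subsetI)
    fix e assume e: "e \<in> ?G"
    obtain a b where ab: "e = (a, b)" by (cases e)
    then have "a \<in> C \<or> b \<in> C" using C(2)[of a b] e by simp
    then show "e \<in> \<Union>(star ?G ` C)"
    proof
      assume "a \<in> C"
      then show ?thesis using e ab by (intro UN_I[of a]) (simp_all add: star_def)
    next
      assume "b \<in> C"
      then show ?thesis using e ab by (intro UN_I[of b]) (simp_all add: star_def)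
    qed
  qed (auto simp: star_def)
  have "card (star ?G ` C) \<le> card C" by (rule card_image_le[OF C(1)])
  then have "koszul_vanishes (mon_ideal (X \<union> Y) (up_set (edge_products ?G s)) :: ('v, 'k) mpoly set) (Suc i) d"
    if "int i + B < d" for i d
    by (intro koszul_vanishes_power[OF _ _ cover])
      (use C(1) chain_graph_star[OF G XY(3)] that in \<open>auto simp: B_def\<close>)
  then have "regularity (X \<union> Y) (mon_ideal (X \<union> Y) (up_set (edge_products ?G s)) :: ('v, 'k) mpoly set)
      \<le> ereal (real_of_int B)"
    by (intro regularity_le) (use s in \<open>simp_all add: B_def\<close>)
  moreover have "real_of_int B = 2 * real s + (real (card C) - 1)" by (simp add: B_def)
  ultimately show ?thesis unfolding ideal_power_edge_ideal_eq by simp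
qed

lemma maximal_matching_covers:
  assumes M: "maximal_matching E M" and e: "e \<in> E" "e \<noteq> {}"
  shows "e \<inter> \<Union>M \<noteq> {}"
proof
  assume disjnt: "e \<inter> \<Union>M = {}"
  have "matching E M" using M unfolding maximal_matching_def by simp
  then have "matching E (insert e M)"
    using e disjnt unfolding matching_def by (simp add: Int_commute) blast
  then have "insert e M = M" using M unfolding maximal_matching_def by blast
  then show False using e disjnt by blast
qed

lemma min_max_matching_attained:
  assumes "finite E"
  obtains M where "maximal_matching E M" "card M = min_max_matching_number E"
proof -
  have fin: "finite {M. matching E M}"
    using assms by (rule rev_finite_subset[OF finite_Pow_iff[THEN iffD2]]) (auto simp: matching_def)
  have "{} \<in> {M. matching E M}" by (simp add: matching_def)
  then have "{M. matching E M} \<noteq> {}" by blast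
  then have "\<exists>M\<in>{M. matching E M}. \<forall>M'\<in>{M. matching E M}. M \<subseteq> M' \<longrightarrow> M = M'"
    by (rule finite_has_maximal[OF fin])
  then have "\<exists>M. maximal_matching E M"
    unfolding maximal_matching_def by (simp add: eq_commute)
  then have "card ` {M. maximal_matching E M} \<noteq> {}" by simp
  moreover have "finite (card ` {M. maximal_matching E M})"
    by (intro finite_imageI finite_subset[OF _ fin]) (auto simp: maximal_matching_def)
  ultimately have "min_max_matching_number E \<in> card ` {M. maximal_matching E M}"
    unfolding min_max_matching_number_def by (intro Min_in)
  then obtain M where "M \<in> {M. maximal_matching E M}" "min_max_matching_number E = card M"
    by (rule imageE)
  then show ?thesis using that[of M] by simp
qed

theorem corollary3p8:
  fixes X Y :: "'v set" and E :: "'v set set" and s :: nat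
  assumes "bipartite_graph X Y E"
    and "s \<ge> 1"
  shows "regularity (X \<union> Y) (ideal_power (X \<union> Y) (edge_ideal X Y E :: ('v, 'k::field) mpoly set) s)
    \<le> ereal (2 * real s +
        Min {real (card X) - 1, real (card Y) - 1, 2 * real (min_max_matching_number E) - 1})"
proof -
  let ?reg = "regularity (X \<union> Y) (ideal_power (X \<union> Y) (edge_ideal X Y E :: ('v, 'k) mpoly set) s)"
  have XY: "finite X" "finite Y" "X \<inter> Y = {}" and edges: "\<And>e. e \<in> E \<Longrightarrow> \<exists>x\<in>X. \<exists>y\<in>Y. e = {x, y}"
    using assms(1) unfolding bipartite_graph_def by blast+
  note bound = regularity_le_vertex_cover[OF XY assms(2), where E = E and ?'k = 'k]
  have 1: "?reg \<le> ereal (2 * real s + (real (card X) - 1))"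
    by (rule bound[OF XY(1)]) (auto simp: bipartite_edges_def)
  have 2: "?reg \<le> ereal (2 * real s + (real (card Y) - 1))"
    by (rule bound[OF XY(2)]) (auto simp: bipartite_edges_def)
  have 3: "?reg \<le> ereal (2 * real s + (2 * real (min_max_matching_number E) - 1))"
  proof -
    have "E \<subseteq> Pow (X \<union> Y)"
    proof
      fix e assume "e \<in> E"
      from edges[OF this] obtain x y where "x \<in> X" "y \<in> Y" "e = {x, y}" by blast
      then show "e \<in> Pow (X \<union> Y)" by simp
    qed
    then have "finite E" by (rule finite_subset) (simp add: XY)
    then obtain M where M: "maximal_matching E M" "card M = min_max_matching_number E"
      by (rule min_max_matching_attained)
    have ME: "M \<subseteq> E" using M(1) unfolding maximal_matching_def matching_def by blast
    have finM: "finite M" using ME \<open>finite E\<close> by (rule finite_subset)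
    have pair: "finite e \<and> card e \<le> 2" if "e \<in> M" for e
    proof -
      have "e \<in> E" using ME that by blast
      from edges[OF this] obtain x y where "e = {x, y}" by blast
      then show ?thesis by (simp add: card_insert_if)
    qed
    have "card (\<Union>M) \<le> (\<Sum>e\<in>M. card e)" by (rule card_Union_le_sum_card)
    also have "\<dots> \<le> (\<Sum>e\<in>M. 2)" by (rule sum_mono) (use pair in blast)
    finally have card: "card (\<Union>M) \<le> 2 * min_max_matching_number E" using M(2) by simp
    have "?reg \<le> ereal (2 * real s + (real (card (\<Union>M)) - 1))"
    proof (rule bound)
      show "finite (\<Union>M)" using finM pair by blast
      fix a b assume "(a, b) \<in> bipartite_edges X Y E"
      then have "{a, b} \<in> E" unfolding bipartite_edges_def by blast
      then have "{a, b} \<inter> \<Union>M \<noteq> {}" by (rule maximal_matching_covers[OF M(1)]) simp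
      then show "a \<in> \<Union>M \<or> b \<in> \<Union>M" by blast
    qed
    also have "\<dots> \<le> ereal (2 * real s + (2 * real (min_max_matching_number E) - 1))"
      using card by simp
    finally show ?thesis .
  qed
  have "Min {a, b, c} \<in> {a, b, c}" for a b c :: real by (rule Min_in) simp_all
  then have "Min {real (card X) - 1, real (card Y) - 1, 2 * real (min_max_matching_number E) - 1}
      \<in> {real (card X) - 1, real (card Y) - 1, 2 * real (min_max_matching_number E) - 1}" .
  then show ?thesis using 1 2 3 by (elim insertE emptyE) (simp_all only:)
qed

end
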